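(* Let $\mathcal{C}$ be an abelian $K$-linear category, let $L/K$ be a finite Galois extension with group $G$, and let $\mathcal{C}_L$ be the base-changed category. Let $M$ be an object of $\mathcal{C}_L$ such that (1) $M\cong {}^gM$ for all $g\in G$, and (2) the natural map $L\to\mathrm{End}_{\mathcal{C}_L}(M)$ is an isomorphism. Then the cohomology class $\xi_M$ is $0$ in $H^2(K,\mathbb{G}_m)$ if and only if $M$ descends to $\mathcal{C}$.
   Context: $K$ is a field. Objects of $\mathcal{C}_L$ are pairs $(N,f)$ with $N$ an object of $\mathcal{C}$ and $f:L\to\mathrm{End}_{\mathcal{C}}(N)$ a homomorphism of $K$-algebras; morphisms are morphisms of $\mathcal{C}$ compatible with the $L$-structures. The induction functor $\mathrm{Ind}_K^L:\mathcal{C}\to\mathcal{C}_L$ sends $N$ to $L\otimes_K N$ (a direct sum of $[L:K]$ copies of $N$) with its natural $L$-structure. $G$ acts on $\mathcal{C}_L$ by ${}^g(N,f)=(N,f\circ g^{-1})$, and acts on morphisms by leaving the underlying morphism of $\mathcal{C}$ unchanged; a scalar $\lambda\in L$ acting on $M$ becomes the scalar $g(\lambda)$ on ${}^gM$. An object descends if it is isomorphic to an object in the image of $\mathrm{Ind}_K^L$. The class $\xi_M$: choose for each $g\in G$ an isomorphism $c_g:M\to{}^gM$ and set $\xi_{M,c}(g,h)=c_{gh}^{-1}\circ{}^gc_h\circ c_g\in\mathrm{Aut}_{\mathcal{C}_L}(M)\cong L^*$. This is a 2-cocycle of $G$ with values in $L^*$ whose class $\xi_M\in H^2(G,L^* )\subset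 H^2(K,\mathbb{G}_m)$ is independent of the choice of the $c_g$. *)

theory Defs
  imports
    "HOL-Analysis.Function_Topology"
    "HOL-Analysis.Product_Topology"
    "HOL-Computational_Algebra.Polynomial"
    "HOL-Algebra.Algebra"
    "HOL-Algebra.Algebraic_Closure_Type"
begin

section \<open>Linear and abelian categories\<close>

text \<open>
  Arrows carry no domain or codomain, and hom-sets need not be disjoint: \<open>Hom C A B\<close> says which
  arrows go from \<open>A\<close> to \<open>B\<close>.  This way the hom-sets of a category of objects with extra structure
  are literally subsets of the hom-sets of the underlying category.
  \<open>Comp C g f\<close> is the composite ``\<open>g\<close> after \<open>f\<close>''.
\<close>

record ('k, 'o, 'm) lincat =
  Ob :: "'o set"
  Hom :: "'o \<Rightarrow> 'o \<Rightarrow> 'm set"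
  Comp :: "'m \<Rightarrow> 'm \<Rightarrow> 'm"
  Ident :: "'o \<Rightarrow> 'm"
  Add :: "'m \<Rightarrow> 'm \<Rightarrow> 'm"
  Zero :: "'o \<Rightarrow> 'o \<Rightarrow> 'm"
  Scale :: "'k \<Rightarrow> 'm \<Rightarrow> 'm"

text \<open>
  The module of arrows from \<open>A\<close> to \<open>B\<close>.  The multiplicative fields are meaningful only if
  \<open>A = B\<close>; in that case this is the endomorphism algebra of \<open>A\<close>.
\<close>

definition hom_space :: "('k, 'o, 'm) lincat \<Rightarrow> 'o \<Rightarrow> 'o \<Rightarrow> ('k, 'm) module" where
  "hom_space C A B =
    \<lparr>carrier = Hom C A B, monoid.mult = Comp C, one = Ident C A,
     ring.zero = Zero C A B, add = Add C, module.smult = Scale C\<rparr>"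

locale linear_category =
  fixes C :: "('k::field, 'o, 'm) lincat"
  assumes comp_in_Hom: "\<lbrakk>A \<in> Ob C; B \<in> Ob C; D \<in> Ob C; f \<in> Hom C A B; g \<in> Hom C B D\<rbrakk>
      \<Longrightarrow> Comp C g f \<in> Hom C A D"
    and ident_in_Hom: "A \<in> Ob C \<Longrightarrow> Ident C A \<in> Hom C A A"
    and comp_assoc: "\<lbrakk>A \<in> Ob C; B \<in> Ob C; D \<in> Ob C; E \<in> Ob C;
        f \<in> Hom C A B; g \<in> Hom C B D; h \<in> Hom C D E\<rbrakk>
      \<Longrightarrow> Comp C h (Comp C g f) = Comp C (Comp C h g) f"
    and comp_ident_left: "\<lbrakk>A \<in> Ob C; B \<in> Ob C; f \<in> Hom C A B\<rbrakk> \<Longrightarrow> Comp C (Ident C B) f = f"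
    and comp_ident_right: "\<lbrakk>A \<in> Ob C; B \<in> Ob C; f \<in> Hom C A B\<rbrakk> \<Longrightarrow> Comp C f (Ident C A) = f"
    and hom_module: "\<lbrakk>A \<in> Ob C; B \<in> Ob C\<rbrakk>
      \<Longrightarrow> Module.module (ring_of_type_algebra :: 'k ring) (hom_space C A B)"
    and comp_add_left: "\<lbrakk>A \<in> Ob C; B \<in> Ob C; D \<in> Ob C; f \<in> Hom C A B;
        g \<in> Hom C B D; g' \<in> Hom C B D\<rbrakk>
      \<Longrightarrow> Comp C (Add C g g') f = Add C (Comp C g f) (Comp C g' f)"
    and comp_add_right: "\<lbrakk>A \<in> Ob C; B \<in> Ob C; D \<in> Ob C; f \<in> Hom C A B; f' \<in> Hom C A B;
        g \<in> Hom C B D\<rbrakk>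
      \<Longrightarrow> Comp C g (Add C f f') = Add C (Comp C g f) (Comp C g f')"
    and comp_scale_left: "\<lbrakk>A \<in> Ob C; B \<in> Ob C; D \<in> Ob C; f \<in> Hom C A B; g \<in> Hom C B D\<rbrakk>
      \<Longrightarrow> Comp C (Scale C k g) f = Scale C k (Comp C g f)"
    and comp_scale_right: "\<lbrakk>A \<in> Ob C; B \<in> Ob C; D \<in> Ob C; f \<in> Hom C A B; g \<in> Hom C B D\<rbrakk>
      \<Longrightarrow> Comp C g (Scale C k f) = Scale C k (Comp C g f)"

definition inverse_pair :: "('k, 'o, 'm) lincat \<Rightarrow> 'o \<Rightarrow> 'o \<Rightarrow> 'm \<Rightarrow> 'm \<Rightarrow> bool" where
  "inverse_pair C A B f f' \<longleftrightarrow> f \<in> Hom C A B \<and> f' \<in> Hom C B A \<and>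
     Comp C f' f = Ident C A \<and> Comp C f f' = Ident C B"

definition isos :: "('k, 'o, 'm) lincat \<Rightarrow> 'o \<Rightarrow> 'o \<Rightarrow> 'm set" where
  "isos C A B = {f. \<exists>f'. inverse_pair C A B f f'}"

definition inverse_arrow :: "('k, 'o, 'm) lincat \<Rightarrow> 'o \<Rightarrow> 'o \<Rightarrow> 'm \<Rightarrow> 'm" where
  "inverse_arrow C A B f = (THE f'. inverse_pair C A B f f')"

definition isomorphic :: "('k, 'o, 'm) lincat \<Rightarrow> 'o \<Rightarrow> 'o \<Rightarrow> bool" where
  "isomorphic C A B \<longleftrightarrow> isos C A B \<noteq> {}"

definition zero_object :: "('k, 'o, 'm) lincat \<Rightarrow> 'o \<Rightarrow> bool" where
  "zero_object C Z \<longleftrightarrow> Z \<in> Ob C \<and>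
     (\<forall>A\<in>Ob C. (\<exists>!f. f \<in> Hom C Z A) \<and> (\<exists>!f. f \<in> Hom C A Z))"

text \<open>\<open>P\<close> is the direct sum (biproduct) of the finite family \<open>(A i)\<^sub>i\<^sub>\<in>\<^sub>I\<close>.\<close>

definition direct_sum ::
  "('k, 'o, 'm) lincat \<Rightarrow> 'i set \<Rightarrow> ('i \<Rightarrow> 'o) \<Rightarrow> 'o \<Rightarrow> ('i \<Rightarrow> 'm) \<Rightarrow> ('i \<Rightarrow> 'm) \<Rightarrow> bool" where
  "direct_sum C I A P inc prj \<longleftrightarrow> finite I \<and> P \<in> Ob C \<and>
     (\<forall>i\<in>I. inc i \<in> Hom C (A i) P \<and> prj i \<in> Hom C P (A i)) \<and>
     (\<forall>i\<in>I. \<forall>i'\<in>I. Comp C (prj i') (inc i) = (if i' = i then Ident C (A i) else Zero C (A i) (A i'))) \<and>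
     (\<Oplus>\<^bsub>hom_space C P P\<^esub> i \<in> I. Comp C (inc i) (prj i)) = Ident C P"

definition kernel_of :: "('k, 'o, 'm) lincat \<Rightarrow> 'o \<Rightarrow> 'o \<Rightarrow> 'm \<Rightarrow> 'o \<Rightarrow> 'm \<Rightarrow> bool" where
  "kernel_of C A B f N i \<longleftrightarrow> N \<in> Ob C \<and> i \<in> Hom C N A \<and> Comp C f i = Zero C N B \<and>
     (\<forall>Y\<in>Ob C. \<forall>h\<in>Hom C Y A. Comp C f h = Zero C Y B \<longrightarrow> (\<exists>!u. u \<in> Hom C Y N \<and> Comp C i u = h))"

definition cokernel_of :: "('k, 'o, 'm) lincat \<Rightarrow> 'o \<Rightarrow> 'o \<Rightarrow> 'm \<Rightarrow> 'o \<Rightarrow> 'm \<Rightarrow> bool" where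
  "cokernel_of C A B f Q p \<longleftrightarrow> Q \<in> Ob C \<and> p \<in> Hom C B Q \<and> Comp C p f = Zero C A Q \<and>
     (\<forall>Y\<in>Ob C. \<forall>h\<in>Hom C B Y. Comp C h f = Zero C A Y \<longrightarrow> (\<exists>!u. u \<in> Hom C Q Y \<and> Comp C u p = h))"

definition monic :: "('k, 'o, 'm) lincat \<Rightarrow> 'o \<Rightarrow> 'o \<Rightarrow> 'm \<Rightarrow> bool" where
  "monic C A B f \<longleftrightarrow> f \<in> Hom C A B \<and>
     (\<forall>Y\<in>Ob C. \<forall>u\<in>Hom C Y A. \<forall>v\<in>Hom C Y A. Comp C f u = Comp C f v \<longrightarrow> u = v)"

definition epic :: "('k, 'o, 'm) lincat \<Rightarrow> 'o \<Rightarrow> 'o \<Rightarrow> 'm \<Rightarrow> bool" where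
  "epic C A B f \<longleftrightarrow> f \<in> Hom C A B \<and>
     (\<forall>Y\<in>Ob C. \<forall>u\<in>Hom C B Y. \<forall>v\<in>Hom C B Y. Comp C u f = Comp C v f \<longrightarrow> u = v)"

locale abelian_linear_category = linear_category C for C :: "('k::field, 'o, 'm) lincat" +
  assumes has_zero_object: "\<exists>Z. zero_object C Z"
    and has_biproducts: "\<lbrakk>A \<in> Ob C; B \<in> Ob C\<rbrakk>
      \<Longrightarrow> \<exists>P inc prj. direct_sum C (UNIV :: bool set) (\<lambda>b. if b then A else B) P inc prj"
    and has_kernels: "\<lbrakk>A \<in> Ob C; B \<in> Ob C; f \<in> Hom C A B\<rbrakk> \<Longrightarrow> \<exists>N i. kernel_of C A B f N i"
    and has_cokernels: "\<lbrakk>A \<in> Ob C; B \<in> Ob C; f \<in> Hom C A B\<rbrakk> \<Longrightarrow> \<exists>Q p. cokernel_of C A B f Q p"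
    and monic_is_kernel: "\<lbrakk>A \<in> Ob C; B \<in> Ob C; monic C A B f\<rbrakk>
      \<Longrightarrow> \<exists>D\<in>Ob C. \<exists>g\<in>Hom C B D. kernel_of C B D g A f"
    and epic_is_cokernel: "\<lbrakk>A \<in> Ob C; B \<in> Ob C; epic C A B f\<rbrakk>
      \<Longrightarrow> \<exists>D\<in>Ob C. \<exists>g\<in>Hom C D A. cokernel_of C D A g B f"


section \<open>Galois extensions\<close>

text \<open>A field extension is given by a ring homomorphism \<open>\<iota>\<close> between two types of class field.\<close>

definition field_extension :: "('k::field \<Rightarrow> 'l::field) \<Rightarrow> bool" where
  "field_extension \<iota> \<longleftrightarrow> \<iota> \<in> ring_hom ring_of_type_algebra ring_of_type_algebra"

definition finite_basis :: "('k::field \<Rightarrow> 'l::field) \<Rightarrow> 'l set \<Rightarrow> bool" where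
  "finite_basis \<iota> B \<longleftrightarrow> finite B \<and> \<not> Modules.module.dependent (\<lambda>k x. \<iota> k * x) B \<and>
     Modules.module.span (\<lambda>k x. \<iota> k * x) B = UNIV"

definition gal :: "('k::field \<Rightarrow> 'l::field) \<Rightarrow> ('l \<Rightarrow> 'l) monoid" where
  "gal \<iota> = \<lparr>carrier = {g \<in> ring_iso ring_of_type_algebra ring_of_type_algebra. \<forall>k. g (\<iota> k) = \<iota> k},
            monoid.mult = (\<circ>), one = id\<rparr>"

text \<open>Not necessarily finite: algebraic, and the base field is the fixed field of the automorphisms.\<close>

definition galois_extension :: "('k::field \<Rightarrow> 'l::field) \<Rightarrow> bool" where
  "galois_extension \<iota> \<longleftrightarrow> field_extension \<iota> \<and>
     (\<forall>x. \<exists>p. p \<noteq> 0 \<and> poly (map_poly \<iota> p) x = 0) \<and>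
     {x. \<forall>g\<in>carrier (gal \<iota>). g x = x} = range \<iota>"

definition separable_closure :: "('k::field \<Rightarrow> 's::field) \<Rightarrow> bool" where
  "separable_closure \<kappa> \<longleftrightarrow> galois_extension \<kappa> \<and>
     (\<forall>p :: 's poly. degree p > 0 \<and> coprime p (pderiv p) \<longrightarrow> (\<exists>x. poly p x = 0))"

text \<open>
  The Krull topology.  Sets of automorphisms with prescribed values at finitely many elements form
  a basis; since the extension is algebraic, these are the cosets of the stabilizers of finite
  subextensions.
\<close>

definition krull_topology :: "('k::field \<Rightarrow> 'l::field) \<Rightarrow> ('l \<Rightarrow> 'l) topology" where
  "krull_topology \<iota> =
     subtopology (product_topology (\<lambda>_. discrete_topology UNIV) UNIV) (carrier (gal \<iota>))"


section \<open>Second cohomology groups\<close>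

text \<open>
  Continuous cohomology of a group \<open>G\<close> with topology \<open>T\<close> on its carrier, acting through \<open>act\<close> on
  the discrete (multiplicatively written) abelian group \<open>A\<close>.
\<close>

definition cocycles2 ::
  "('g, 'x) monoid_scheme \<Rightarrow> 'g topology \<Rightarrow> ('a, 'y) monoid_scheme \<Rightarrow> ('g \<Rightarrow> 'a \<Rightarrow> 'a)
    \<Rightarrow> ('g \<times> 'g \<Rightarrow> 'a) monoid" where
  "cocycles2 G T A act =
    \<lparr>carrier = {z \<in> extensional (carrier G \<times> carrier G).
        continuous_map (prod_topology T T) (discrete_topology (carrier A)) z \<and>
        (\<forall>g\<in>carrier G. \<forall>h\<in>carrier G. \<forall>k\<in>carrier G.
          act g (z (h, k)) \<otimes>\<^bsub>A\<^esub> z (g, h \<otimes>\<^bsub>G\<^esub> k) = z (g \<otimes>\<^bsub>G\<^esub> h, k) \<otimes>\<^bsub>A\<^esub> z (g, h))},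
     monoid.mult = (\<lambda>z w. \<lambda>p\<in>carrier G \<times> carrier G. z p \<otimes>\<^bsub>A\<^esub> w p),
     one = (\<lambda>p\<in>carrier G \<times> carrier G. \<one>\<^bsub>A\<^esub>)\<rparr>"

definition coboundary ::
  "('g, 'x) monoid_scheme \<Rightarrow> ('a, 'y) monoid_scheme \<Rightarrow> ('g \<Rightarrow> 'a \<Rightarrow> 'a)
    \<Rightarrow> ('g \<Rightarrow> 'a) \<Rightarrow> ('g \<times> 'g \<Rightarrow> 'a)" where
  "coboundary G A act b =
    (\<lambda>(g, h)\<in>carrier G \<times> carrier G. act g (b h) \<otimes>\<^bsub>A\<^esub> inv\<^bsub>A\<^esub> (b (g \<otimes>\<^bsub>G\<^esub> h)) \<otimes>\<^bsub>A\<^esub> b g)"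

definition coboundaries2 ::
  "('g, 'x) monoid_scheme \<Rightarrow> 'g topology \<Rightarrow> ('a, 'y) monoid_scheme \<Rightarrow> ('g \<Rightarrow> 'a \<Rightarrow> 'a)
    \<Rightarrow> ('g \<times> 'g \<Rightarrow> 'a) set" where
  "coboundaries2 G T A act =
    coboundary G A act ` {b. continuous_map T (discrete_topology (carrier A)) b}"

definition H2 ::
  "('g, 'x) monoid_scheme \<Rightarrow> 'g topology \<Rightarrow> ('a, 'y) monoid_scheme \<Rightarrow> ('g \<Rightarrow> 'a \<Rightarrow> 'a)
    \<Rightarrow> ('g \<times> 'g \<Rightarrow> 'a) set monoid" where
  "H2 G T A act = cocycles2 G T A act Mod coboundaries2 G T A act"

definition H2_class ::
  "('g, 'x) monoid_scheme \<Rightarrow> 'g topology \<Rightarrow> ('a, 'y) monoid_scheme \<Rightarrow> ('g \<Rightarrow> 'a \<Rightarrow> 'a)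
    \<Rightarrow> ('g \<times> 'g \<Rightarrow> 'a) \<Rightarrow> ('g \<times> 'g \<Rightarrow> 'a) set" where
  "H2_class G T A act z = coboundaries2 G T A act #>\<^bsub>cocycles2 G T A act\<^esub> z"

abbreviation units_group :: "'l::field monoid" where
  "units_group \<equiv> mult_of ring_of_type_algebra"

text \<open>
  For a finite Galois extension \<open>\<iota>\<close>: \<open>K \<rightarrow> L\<close> with group \<open>G\<close>, \<open>H2_finite_class \<iota>\<close> maps a cocycle to
  its class in $H^2(G, L^*)$.  For a separable closure \<open>\<kappa>\<close> of \<open>K\<close>, \<open>H2_Gm \<kappa>\<close> is
  $H^2(K, \mathbb{G}_m)$, the continuous cohomology of the absolute Galois group.
\<close>

definition H2_finite_class ::
  "('k::field \<Rightarrow> 'l::field) \<Rightarrow> (('l \<Rightarrow> 'l) \<times> ('l \<Rightarrow> 'l) \<Rightarrow> 'l) \<Rightarrow> (('l \<Rightarrow> 'l) \<times> ('l \<Rightarrow> 'l) \<Rightarrow> 'l) set" where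
  "H2_finite_class \<iota> = H2_class (gal \<iota>) (discrete_topology (carrier (gal \<iota>))) units_group (\<lambda>g x. g x)"

definition H2_Gm :: "('k::field \<Rightarrow> 's::field) \<Rightarrow> (('s \<Rightarrow> 's) \<times> ('s \<Rightarrow> 's) \<Rightarrow> 's) set monoid" where
  "H2_Gm \<kappa> = H2 (gal \<kappa>) (krull_topology \<kappa>) units_group (\<lambda>\<sigma> x. \<sigma> x)"

definition H2_Gm_class ::
  "('k::field \<Rightarrow> 's::field) \<Rightarrow> (('s \<Rightarrow> 's) \<times> ('s \<Rightarrow> 's) \<Rightarrow> 's) \<Rightarrow> (('s \<Rightarrow> 's) \<times> ('s \<Rightarrow> 's) \<Rightarrow> 's) set" where
  "H2_Gm_class \<kappa> = H2_class (gal \<kappa>) (krull_topology \<kappa>) units_group (\<lambda>\<sigma> x. \<sigma> x)"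

text \<open>
  Restriction of an automorphism along the embedding \<open>j\<close>: \<open>L \<rightarrow> S\<close>; used only if the image of \<open>j\<close> is
  stable under \<open>\<sigma>\<close>.
\<close>

definition restrict_aut :: "('l \<Rightarrow> 's) \<Rightarrow> ('s \<Rightarrow> 's) \<Rightarrow> ('l \<Rightarrow> 'l)" where
  "restrict_aut j \<sigma> = inv_into UNIV j \<circ> \<sigma> \<circ> j"

definition inflate ::
  "('k::field \<Rightarrow> 'l::field) \<Rightarrow> ('l \<Rightarrow> 's::field) \<Rightarrow> (('l \<Rightarrow> 'l) \<times> ('l \<Rightarrow> 'l) \<Rightarrow> 'l)
    \<Rightarrow> (('s \<Rightarrow> 's) \<times> ('s \<Rightarrow> 's) \<Rightarrow> 's)" where
  "inflate \<iota> j z = (\<lambda>(\<sigma>, \<tau>)\<in>carrier (gal (j \<circ> \<iota>)) \<times> carrier (gal (j \<circ> \<iota>)).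
     j (z (restrict_aut j \<sigma>, restrict_aut j \<tau>)))"

text \<open>
  The inclusion $H^2(G, L^*) \subset H^2(K, \mathbb{G}_m)$: a class, i.e. a coset of cocycles, is sent
  to the common class of the inflations of its members.
\<close>

definition inflation ::
  "('k::field \<Rightarrow> 'l::field) \<Rightarrow> ('l \<Rightarrow> 's::field) \<Rightarrow> (('l \<Rightarrow> 'l) \<times> ('l \<Rightarrow> 'l) \<Rightarrow> 'l) set
    \<Rightarrow> (('s \<Rightarrow> 's) \<times> ('s \<Rightarrow> 's) \<Rightarrow> 's) set" where
  "inflation \<iota> j Y = the_elem ((\<lambda>z. H2_Gm_class (j \<circ> \<iota>) (inflate \<iota> j z)) ` Y)"


section \<open>Base change of a linear category and descent\<close>

text \<open>
  Only the \<open>K\<close>-linear structure of \<open>C\<^sub>L\<close> is recorded; the scalar \<open>x\<close> in \<open>L\<close> acts on the object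
  \<open>(N, f)\<close> as the endomorphism \<open>f x\<close>.
\<close>

definition base_change ::
  "('k::field \<Rightarrow> 'l::field) \<Rightarrow> ('k, 'o, 'm) lincat \<Rightarrow> ('k, 'o \<times> ('l \<Rightarrow> 'm), 'm) lincat" where
  "base_change \<iota> C =
    \<lparr>Ob = {(N, f). N \<in> Ob C \<and> f \<in> ring_hom ring_of_type_algebra (hom_space C N N) \<and>
              (\<forall>k x. f (\<iota> k * x) = Scale C k (f x))},
     Hom = (\<lambda>(N, f) (N', f'). {\<phi> \<in> Hom C N N'. \<forall>x. Comp C \<phi> (f x) = Comp C (f' x) \<phi>}),
     Comp = Comp C,
     Ident = (\<lambda>(N, f). Ident C N),
     Add = Add C,
     Zero = (\<lambda>(N, f) (N', f'). Zero C N N'),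
     Scale = Scale C\<rparr>"

definition twist :: "('l \<Rightarrow> 'l) \<Rightarrow> 'o \<times> ('l \<Rightarrow> 'm) \<Rightarrow> 'o \<times> ('l \<Rightarrow> 'm)" where
  "twist g = (\<lambda>(N, f). (N, f \<circ> inv_into UNIV g))"

text \<open>
  \<open>P\<close> is (a model of) $L \otimes_K N$, with \<open>t x\<close> the arrow $x \otimes {-}$ from \<open>N\<close>: for a \<open>K\<close>-basis
  \<open>B\<close> of \<open>L\<close> the arrows \<open>t b\<close> exhibit the underlying object as the direct sum of copies of \<open>N\<close>
  indexed by \<open>B\<close>, and \<open>L\<close> acts through the left factor.
\<close>

definition is_induced ::
  "('k::field \<Rightarrow> 'l::field) \<Rightarrow> ('k, 'o, 'm) lincat \<Rightarrow> 'o \<Rightarrow> 'o \<times> ('l \<Rightarrow> 'm) \<Rightarrow> bool" where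
  "is_induced \<iota> C N P \<longleftrightarrow> P \<in> Ob (base_change \<iota> C) \<and>
     (\<exists>B t prj. finite_basis \<iota> B \<and>
        (\<forall>x. t x \<in> Hom C N (fst P)) \<and>
        (\<forall>x y. t (x + y) = Add C (t x) (t y)) \<and>
        (\<forall>k x. t (\<iota> k * x) = Scale C k (t x)) \<and>
        direct_sum C B (\<lambda>_. N) (fst P) t prj \<and>
        (\<forall>x y. Comp C (snd P x) (t y) = t (x * y)))"

definition descends ::
  "('k::field \<Rightarrow> 'l::field) \<Rightarrow> ('k, 'o, 'm) lincat \<Rightarrow> 'o \<times> ('l \<Rightarrow> 'm) \<Rightarrow> bool" where
  "descends \<iota> C M \<longleftrightarrow>
     (\<exists>N\<in>Ob C. \<exists>P. is_induced \<iota> C N P \<and> isomorphic (base_change \<iota> C) M P)"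

text \<open>
  The cocycle $c_{gh}^{-1} \circ {}^g c_h \circ c_g$, as a function with values in \<open>L\<close> through the
  identification of \<open>L\<close> with the endomorphisms of \<open>M\<close>.  The arrow ${}^g c_h$ is \<open>c h\<close>, now
  regarded as an arrow from \<open>twist g M\<close> to \<open>twist (g \<circ> h) M\<close>.
\<close>

definition xi_cocycle ::
  "('k::field \<Rightarrow> 'l::field) \<Rightarrow> ('k, 'o, 'm) lincat \<Rightarrow> 'o \<times> ('l \<Rightarrow> 'm) \<Rightarrow> (('l \<Rightarrow> 'l) \<Rightarrow> 'm)
    \<Rightarrow> (('l \<Rightarrow> 'l) \<times> ('l \<Rightarrow> 'l) \<Rightarrow> 'l)" where
  "xi_cocycle \<iota> C M c = (\<lambda>(g, h)\<in>carrier (gal \<iota>) \<times> carrier (gal \<iota>).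
     THE x. snd M x =
       Comp C (inverse_arrow (base_change \<iota> C) M (twist (g \<circ> h) M) (c (g \<circ> h)))
         (Comp C (c h) (c g)))"

definition xi_class ::
  "('k::field \<Rightarrow> 'l::field) \<Rightarrow> ('k, 'o, 'm) lincat \<Rightarrow> 'o \<times> ('l \<Rightarrow> 'm) \<Rightarrow> (('l \<Rightarrow> 'l) \<Rightarrow> 'm)
    \<Rightarrow> (('l \<Rightarrow> 'l) \<times> ('l \<Rightarrow> 'l) \<Rightarrow> 'l) set" where
  "xi_class \<iota> C M c = H2_finite_class \<iota> (xi_cocycle \<iota> C M c)"

end

theory Submission
  imports Defs
begin

text \<open>
  A family of isomorphisms \<open>c g\<close> has trivial class in $H^2(G, L^*)$ iff it can be rescaled by
  elements of \<open>L\<close> to a descent datum, i.e. to one with \<open>c h \<circ> c g = c (g \<circ> h)\<close>.  An induced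
  object carries the descent datum $g^{-1} \otimes 1$.  Conversely, if \<open>a\<close> has trace 1 then, for a
  descent datum, \<open>\<Sum>\<^sub>g c g \<circ> a\<close> is an idempotent of the underlying object \<open>N0\<close>; its image \<open>N\<close> satisfies
  $L \otimes_K N \cong M$, the projections being given by the basis dual to a given one under the
  trace form.  The class is already trivial over \<open>G\<close> if its inflation is: Hilbert's Theorem 90 for
  the extension \<open>S / L\<close> allows us to normalise a trivialising cochain so that it takes values in \<open>L\<close>
  and factors through \<open>G\<close>.
\<close>

section \<open>Galois extensions\<close>

text \<open>Twisting changes only the \<open>L\<close>-structure, so scalars and the isomorphisms
  \<open>c g\<close> all live in one ring, the endomorphisms of the underlying object, where they
  satisfy the relations of a crossed product. Hypothesis (2) says that the commutant of
  \<open>L\<close> in this ring is \<open>L\<close> itself; hence two choices of the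
  \<open>c g\<close> differ by scalars. The trace computations rest on Dedekind's independence of
  automorphisms, which yields an element of trace 1 in every characteristic; averaging over
  \<open>G\<close> would mean dividing by its order. The class lives in the continuous cohomology of
  the group of \<open>S\<close> over \<open>K\<close>, which may be infinite. So a trivialising
  cochain has to be brought down to the finite group \<open>G\<close>, and sums over the kernel of
  restriction have to be cut down to finite ones by continuity. Galois means here: algebraic with
  the right fixed field. That automorphisms of \<open>L\<close> extend to \<open>S\<close>, and that
  the kernel of restriction has fixed field \<open>L\<close>, are both derived from dual bases, by
  expanding an element with traces as coordinates. Cochains are not normalised, whence the quotients
  by \<open>b id\<close>.\<close>

lemma field_extension_iff:
  "field_extension f \<longleftrightarrow> f 1 = 1 \<and> (\<forall>x y. f (x + y) = f x + f y) \<and> (\<forall>x y. f (x * y) = f x * f y)"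
  unfolding field_extension_def ring_hom_def ring_of_type_algebra_def by auto

locale field_embedding =
  fixes f :: "'a::field \<Rightarrow> 'b::field"
  assumes field_extension: "field_extension f"
begin

lemma hom_one [simp]: "f 1 = 1"
  and hom_add [simp]: "f (x + y) = f x + f y"
  and hom_mult [simp]: "f (x * y) = f x * f y"
  using field_extension unfolding field_extension_iff by auto

lemma hom_zero [simp]: "f 0 = 0"
  using hom_add[of 0 0] by (metis add_0_left add_right_cancel)

lemma hom_uminus [simp]: "f (- x) = - f x"
  using hom_add[of x "- x"] by (simp add: eq_neg_iff_add_eq_0 add.commute del: hom_add)

lemma hom_diff [simp]: "f (x - y) = f x - f y"
  using hom_add[of x "- y"] by (simp del: hom_add)

lemma hom_eq_0_iff [simp]: "f x = 0 \<longleftrightarrow> x = 0"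
proof
  assume "f x = 0"
  then have "x \<noteq> 0 \<Longrightarrow> f (x * inverse x) = 0"
    unfolding hom_mult by simp
  then show "x = 0" by auto
qed simp

lemma inj: "inj f"
proof (rule injI)
  fix x y assume "f x = f y"
  then have "f (x - y) = 0" by (simp only: hom_diff) simp
  then show "x = y" by (simp del: hom_diff)
qed

lemma hom_inverse [simp]: "f (inverse x) = inverse (f x)"
proof (cases "x = 0")
  case False
  have "f x * f (inverse x) = 1"
    using False hom_mult[of x "inverse x"] by (simp del: hom_mult)
  then show ?thesis by (simp add: inverse_unique)
qed simp

lemma hom_divide [simp]: "f (x / y) = f x / f y"
  by (simp add: field_class.field_divide_inverse)

lemma hom_sum: "f (sum g A) = (\<Sum>x\<in>A. f (g x))"
  by (induction A rule: infinite_finite_induct) auto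

lemma map_poly_mult: "map_poly f (p * q) = map_poly f p * map_poly f q"
  by (rule poly_eqI) (simp add: coeff_map_poly coeff_mult hom_sum)

lemma map_poly_prod: "map_poly f (prod q A) = (\<Prod>x\<in>A. map_poly f (q x))"
  by (induction A rule: infinite_finite_induct) (auto simp: map_poly_mult)

lemma poly_map_poly: "poly (map_poly f p) (f x) = f (poly p x)"
  by (induction p) (simp_all add: map_poly_pCons)

lemma map_poly_eq_0_iff: "map_poly f p = 0 \<longleftrightarrow> p = 0"
  by (simp add: poly_eq_iff coeff_map_poly)

text \<open>This scaling is the one in \<open>finite_basis\<close>, so span and independence in the
  sense of the locale are those of a basis of \<open>L\<close> over \<open>K\<close>.\<close>

sublocale vector_space "\<lambda>k x. f k * x"
  by unfold_locales (simp_all add: algebra_simps)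

end

section \<open>Automorphism groups, independence of automorphisms and the trace form\<close>

lemma carrier_gal_iff:
  "g \<in> carrier (gal \<iota>) \<longleftrightarrow> field_extension g \<and> bij g \<and> (\<forall>k. g (\<iota> k) = \<iota> k)"
  by (auto simp: gal_def ring_iso_def field_extension_def ring_of_type_algebra_def)

lemma mult_gal [simp]: "monoid.mult (gal \<iota>) = (\<circ>)"
  and one_gal [simp]: "one (gal \<iota>) = id"
  by (simp_all add: gal_def)

lemma galD:
  assumes "g \<in> carrier (gal \<iota>)"
  shows "field_extension g" "bij g" "g (\<iota> k) = \<iota> k"
  using assms by (auto simp: carrier_gal_iff)

lemma gal_embedding: "g \<in> carrier (gal \<iota>) \<Longrightarrow> field_embedding g"
  by unfold_locales (rule galD)

lemma gal_id: "id \<in> carrier (gal \<iota>)"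
  by (simp add: carrier_gal_iff field_extension_iff)

lemma gal_comp: "g \<in> carrier (gal \<iota>) \<Longrightarrow> h \<in> carrier (gal \<iota>) \<Longrightarrow> g \<circ> h \<in> carrier (gal \<iota>)"
  by (simp add: carrier_gal_iff field_extension_iff bij_comp)

lemma gal_inv:
  assumes "g \<in> carrier (gal \<iota>)"
  shows "inv_into UNIV g \<in> carrier (gal \<iota>)"
proof -
  interpret field_embedding g by (rule gal_embedding[OF assms])
  have i: "inv_into UNIV g (g x) = x" "g (inv_into UNIV g x) = x" for x
    using galD(2)[OF assms] by (simp_all add: bij_is_inj bij_is_surj surj_f_inv_f)
  have "inv_into UNIV g y = x \<longleftrightarrow> y = g x" for x y
    using i by metis
  then show ?thesis
    using galD[OF assms] i by (auto simp: carrier_gal_iff field_extension_iff bij_imp_bij_inv)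
qed

lemma gal_inv_app:
  assumes "g \<in> carrier (gal \<iota>)"
  shows "inv_into UNIV g (g x) = x" "g (inv_into UNIV g x) = x"
  using galD(2)[OF assms] by (simp_all add: bij_is_inj bij_is_surj surj_f_inv_f)

text \<open>Left translation is injective, and an injective self-map of a finite set is onto. The
  set \<open>G\<close> is only assumed closed under composition because the lemma is applied to the
  image of restriction before that image is known to be the whole group.\<close>

lemma gal_comp_image:
  assumes "G \<subseteq> carrier (gal \<iota>)" "\<And>g h. g \<in> G \<Longrightarrow> h \<in> G \<Longrightarrow> g \<circ> h \<in> G"
    "finite G" "g \<in> G"
  shows "bij_betw ((\<circ>) g) G G"
proof -
  have "inj_on ((\<circ>) g) G"
    using galD(2)[of g \<iota>] assms by (auto intro!: inj_onI simp: fun.inj_map_strong bij_is_inj fun_eq_iff inj_eq)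
  moreover have "(\<circ>) g ` G \<subseteq> G" using assms by auto
  ultimately show ?thesis
    using assms(3) endo_inj_surj by (metis bij_betw_def)
qed

lemma gal_comp_bij:
  assumes "g \<in> carrier (gal \<iota>)"
  shows "bij_betw ((\<circ>) g) (carrier (gal \<iota>)) (carrier (gal \<iota>))"
proof (rule bij_betwI[where g = "(\<circ>) (inv_into UNIV g)"])
  show "(\<circ>) g \<in> carrier (gal \<iota>) \<rightarrow> carrier (gal \<iota>)" "(\<circ>) (inv_into UNIV g) \<in> carrier (gal \<iota>) \<rightarrow> carrier (gal \<iota>)"
    using assms by (auto intro: gal_comp gal_inv)
qed (use gal_inv_app[OF assms] in \<open>auto simp: fun_eq_iff\<close>)

text \<open>Subtracting \<open>\<chi> i z\<close> times the relation from its translate by \<open>z\<close> removes the term of \<open>i\<close>.\<close>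

lemma dedekind_independence:
  fixes \<chi> :: "'i \<Rightarrow> 'a::monoid_mult \<Rightarrow> 'l::idom"
  assumes "finite I"
    and E: "\<And>x y. x \<in> E \<Longrightarrow> y \<in> E \<Longrightarrow> x * y \<in> E" "1 \<in> E"
    and "\<And>i x y. i \<in> I \<Longrightarrow> x \<in> E \<Longrightarrow> y \<in> E \<Longrightarrow> \<chi> i (x * y) = \<chi> i x * \<chi> i y"
    and "\<And>i. i \<in> I \<Longrightarrow> \<chi> i 1 = 1"
    and "\<And>i i'. i \<in> I \<Longrightarrow> i' \<in> I \<Longrightarrow> i \<noteq> i' \<Longrightarrow> \<exists>x\<in>E. \<chi> i x \<noteq> \<chi> i' x"
    and "\<And>x. x \<in> E \<Longrightarrow> (\<Sum>i\<in>I. a i * \<chi> i x) = 0"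
    and "i \<in> I"
  shows "a i = 0"
  using assms(1,4-)
proof (induction I arbitrary: a i rule: finite_induct)
  case empty
  then show ?case by simp
next
  case (insert i0 I)
  have zero: "a i = 0" if i: "i \<in> I" for i
  proof -
    obtain z where z: "z \<in> E" "\<chi> i z \<noteq> \<chi> i0 z"
      using insert.prems(3)[of i i0] i insert.hyps by auto
    have "a i * (\<chi> i z - \<chi> i0 z) = 0"
    proof (rule insert.IH[where a = "\<lambda>i. a i * (\<chi> i z - \<chi> i0 z)" and i = i])
      fix x assume x: "x \<in> E"
      have "(\<Sum>i\<in>I. a i * (\<chi> i z - \<chi> i0 z) * \<chi> i x) =
          (\<Sum>i\<in>insert i0 I. a i * (\<chi> i z - \<chi> i0 z) * \<chi> i x)"
        using insert.hyps by simp
      also have "\<dots> = (\<Sum>i\<in>insert i0 I. a i * \<chi> i (z * x)) - \<chi> i0 z * (\<Sum>i\<in>insert i0 I. a i * \<chi> i x)"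
        unfolding sum_distrib_left sum_subtractf[symmetric]
        by (rule sum.cong) (simp_all add: insert.prems(1) z(1) x algebra_simps)
      also have "\<dots> = 0"
        using insert.prems(4)[OF x] insert.prems(4)[OF E(1)[OF z(1) x]] by simp
      finally show "(\<Sum>i\<in>I. a i * (\<chi> i z - \<chi> i0 z) * \<chi> i x) = 0" .
    qed (use insert.prems i in auto)
    then show ?thesis using z by simp
  qed
  \<comment> \<open>With the other coefficients gone, the relation evaluated at \<open>1\<close>
    leaves only \<open>a i0\<close>.\<close>
  have "a i0 = 0"
    using insert.prems(4)[OF E(2)] insert.hyps zero insert.prems(2) by simp
  then show ?case using zero insert.prems(5) by auto
qed

lemma dedekind_automorphisms:
  fixes \<iota> :: "'k::field \<Rightarrow> 'l::field"
  assumes "finite G" "G \<subseteq> carrier (gal \<iota>)" "\<And>x. (\<Sum>g\<in>G. a g * g x) = 0" "g \<in> G"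
  shows "a g = 0"
proof (rule dedekind_independence[where I = G and E = UNIV and \<chi> = "\<lambda>g. g" and a = a and i = g])
  show "\<And>i x y. i \<in> G \<Longrightarrow> i (x * y) = i x * i y" "\<And>i. i \<in> G \<Longrightarrow> i 1 = 1"
    using assms(2) by (auto simp: carrier_gal_iff field_extension_iff)
qed (use assms in \<open>auto simp: fun_eq_iff\<close>)

text \<open>
  \<open>d\<close> is the basis dual to \<open>B\<close> under the trace form, which is nondegenerate by Dedekind's lemma.
\<close>

lemma dual_basis:
  fixes \<iota> :: "'k::field \<Rightarrow> 'l::field"
  assumes \<iota>: "field_extension \<iota>" and B: "finite_basis \<iota> B"
    and G: "finite G" "G \<subseteq> carrier (gal \<iota>)" "\<And>g h. g \<in> G \<Longrightarrow> h \<in> G \<Longrightarrow> g \<circ> h \<in> G" "id \<in> G"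
    and fixed: "\<And>x. (\<And>g. g \<in> G \<Longrightarrow> g x = x) \<Longrightarrow> x \<in> range \<iota>"
  shows "\<exists>d. (\<forall>b\<in>B. \<forall>b'\<in>B. (\<Sum>g\<in>G. g (d b * b')) = (if b = b' then 1 else 0)) \<and>
    (\<forall>x. (\<Sum>b\<in>B. b * (\<Sum>g\<in>G. g (d b * x))) = x) \<and>
    (\<forall>g\<in>G. (\<Sum>b\<in>B. b * g (d b)) = (if g = id then 1 else 0))"
proof -
  interpret K: field_embedding \<iota> by unfold_locales (rule \<iota>)
  interpret K: finite_dimensional_vector_space "\<lambda>k x. \<iota> k * x" B
    using B unfolding finite_basis_def by unfold_locales auto
  define Tr where "Tr x = (\<Sum>g\<in>G. g x)" for x
  have emb: "field_embedding g" if "g \<in> G" for g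
    using gal_embedding that G(2) by blast
  have Tr_add: "Tr (x + y) = Tr x + Tr y" for x y
    unfolding Tr_def sum.distrib[symmetric]
    by (rule sum.cong) (auto simp: field_embedding.hom_add[OF emb])
  have Tr_scale: "Tr (\<iota> k * x) = \<iota> k * Tr x" for k x
    unfolding Tr_def sum_distrib_left using G(2)
    by (intro sum.cong) (auto simp: field_embedding.hom_mult[OF emb] carrier_gal_iff)
  have Tr_scale': "Tr (y * (\<iota> k * x)) = \<iota> k * Tr (y * x)" for k x y
    by (metis Tr_scale mult.left_commute)
  have Tr_in: "Tr x \<in> range \<iota>" for x
  proof (rule fixed)
    fix g assume g: "g \<in> G"
    have "g (Tr x) = (\<Sum>h\<in>G. (g \<circ> h) x)"
      unfolding Tr_def field_embedding.hom_sum[OF emb[OF g]] by simp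
    also have "\<dots> = Tr x"
      unfolding Tr_def using sum.reindex_bij_betw[OF gal_comp_image[OF G(2,3,1) g], of "\<lambda>h. h x"] by simp
    finally show "g (Tr x) = Tr x" .
  qed
  have Tr_sum: "Tr (sum u A) = (\<Sum>x\<in>A. Tr (u x))" for A and u :: "'l \<Rightarrow> 'l"
  proof (induction A rule: infinite_finite_induct)
    case empty
    then show ?case using Tr_scale[of 0 0] by simp
  qed (use Tr_scale[of 0 0] Tr_add in auto)
  \<comment> \<open>The trace as an element of \<open>K\<close>, since independence of
    \<open>B\<close> speaks of coefficients in \<open>K\<close>.\<close>
  define \<tau> where "\<tau> x = inv_into UNIV \<iota> (Tr x)" for x
  have \<tau>: "\<iota> (\<tau> x) = Tr x" for x
    unfolding \<tau>_def using Tr_in by (simp add: f_inv_into_f)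
  \<comment> \<open>The trace form read as an endomorphism of \<open>L\<close>: the coordinates of
    \<open>\<Phi> y\<close> are the traces of \<open>y * b\<close>. Nondegeneracy makes it
    injective, finite dimension makes it surjective, and a preimage of a basis element
    \<open>b\<close> pairs with the basis to 0 and 1, as a dual basis element should.\<close>
  define \<Phi> where "\<Phi> y = (\<Sum>b\<in>B. Tr (y * b) * b)" for y
  have lin: "Vector_Spaces.linear (\<lambda>k x. \<iota> k * x) (\<lambda>k x. \<iota> k * x) \<Phi>"
    unfolding Vector_Spaces.linear_iff \<Phi>_def
    using K.vector_space_axioms
    by (auto simp: Tr_add Tr_scale distrib_left distrib_right sum.distrib sum_distrib_left mult.assoc)
  have indep: "\<forall>b\<in>B. \<iota> (u b) = 0" if "(\<Sum>b\<in>B. \<iota> (u b) * b) = 0" for u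
    using K.independentD[OF K.independent_Basis K.finite_Basis order.refl that] by simp
  have B_span: "\<exists>u. x = (\<Sum>b\<in>B. \<iota> (u b) * b)" for x
    using K.span_finite[OF K.finite_Basis] K.span_Basis by auto
  have "inj \<Phi>"
  proof -
    interpret \<Phi>: Vector_Spaces.linear "\<lambda>k x. \<iota> k * x" "\<lambda>k x. \<iota> k * x" \<Phi> by (rule lin)
    have "y = 0" if "\<Phi> y = 0" for y
    proof -
      have 0: "\<forall>b\<in>B. Tr (y * b) = 0"
        using indep[of "\<lambda>b. \<tau> (y * b)"] that unfolding \<Phi>_def by (simp add: \<tau>)
      have "Tr (y * x) = 0" for x
      proof -
        obtain u where "x = (\<Sum>b\<in>B. \<iota> (u b) * b)" using B_span by blast
        then have "Tr (y * x) = (\<Sum>b\<in>B. \<iota> (u b) * Tr (y * b))"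
          by (simp add: sum_distrib_left Tr_sum Tr_scale')
        then show ?thesis using 0 by simp
      qed
      then have "(\<Sum>g\<in>G. g y * g x) = 0" for x
        unfolding Tr_def by (simp add: field_embedding.hom_mult[OF emb] cong: sum.cong)
      \<comment> \<open>This is a relation among the automorphisms with coefficients
        \<open>g y\<close>; the coefficient at \<open>id\<close> is \<open>y\<close> itself.\<close>
      from dedekind_automorphisms[OF G(1,2) this G(4)] show "y = 0" by simp
    qed
    then show ?thesis by (simp add: \<Phi>.inj_iff_eq_0)
  qed
  then have surj: "surj \<Phi>"
    using K.linear_inj_imp_surj[OF lin] by blast
  define d where "d = inv_into UNIV \<Phi>"
  have \<Phi>d: "(\<Sum>b\<in>B. Tr (d x * b) * b) = x" for x
    using surj_f_inv_f[OF surj, of x] by (simp add: d_def \<Phi>_def)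
  have 1: "Tr (d b * b') = (if b = b' then 1 else 0)" if "b \<in> B" "b' \<in> B" for b b'
  proof -
    have "(\<Sum>x\<in>B. \<iota> (\<tau> (d b * x) - (if b = x then 1 else 0)) * x) = \<Phi> (d b) - (\<Sum>x\<in>B. if b = x then b else 0)"
      unfolding \<Phi>_def sum_subtractf[symmetric]
      by (rule sum.cong) (auto simp: \<tau> algebra_simps)
    also have "\<dots> = 0"
      using \<Phi>d[of b] that K.finite_Basis by (simp add: \<Phi>_def)
    finally have "\<forall>x\<in>B. \<iota> (\<tau> (d b * x) - (if b = x then 1 else 0)) = 0"
      by (rule indep)
    then show ?thesis using that by (auto simp: \<tau> split: if_splits)
  qed
  have 2: "(\<Sum>b\<in>B. b * Tr (d b * x)) = x" for x
  proof -
    obtain u where u: "x = (\<Sum>b\<in>B. \<iota> (u b) * b)" using B_span by blast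
    have "Tr (d b * x) = \<iota> (u b)" if b: "b \<in> B" for b
    proof -
      have "Tr (d b * x) = (\<Sum>b'\<in>B. \<iota> (u b') * Tr (d b * b'))"
        by (simp add: u sum_distrib_left Tr_sum Tr_scale')
      also have "\<dots> = (\<Sum>b'\<in>B. if b = b' then \<iota> (u b) else 0)"
        by (rule sum.cong) (auto simp: 1 b)
      finally show ?thesis using b K.finite_Basis by simp
    qed
    then show ?thesis using u by (simp add: mult.commute)
  qed
  \<comment> \<open>The expansion of every \<open>x\<close> in the previous fact says that the sums
    over \<open>B\<close> are the coefficients of a linear combination of automorphisms equal to the
    identity. Independence then determines these coefficients.\<close>
  have 3: "(\<Sum>b\<in>B. b * g (d b)) = (if g = id then 1 else 0)" if g: "g \<in> G" for g
  proof -
    have "(\<Sum>b\<in>B. b * g (d b)) - (if g = id then 1 else 0) = 0"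
    proof (rule dedekind_automorphisms[OF G(1,2) _ g])
      fix x
      have "(\<Sum>g\<in>G. (\<Sum>b\<in>B. b * g (d b)) * g x) = (\<Sum>b\<in>B. b * Tr (d b * x))"
        unfolding sum_distrib_right Tr_def sum_distrib_left
        by (subst sum.swap) (auto intro!: sum.cong simp: field_embedding.hom_mult[OF emb] mult.assoc)
      then have "(\<Sum>g\<in>G. (\<Sum>b\<in>B. b * g (d b)) * g x) = x" using 2[of x] by simp
      moreover have "(\<Sum>g\<in>G. (if g = id then 1 else 0) * g x) = x"
      proof -
        have "(\<Sum>g\<in>G. (if g = id then 1 else 0) * g x) = (\<Sum>g\<in>G. if g = id then x else 0)"
          by (rule sum.cong) auto
        then show ?thesis using G by simp
      qed
      ultimately show "(\<Sum>g\<in>G. ((\<Sum>b\<in>B. b * g (d b)) - (if g = id then 1 else 0)) * g x) = 0"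
        by (simp add: left_diff_distrib sum_subtractf)
    qed
    then show ?thesis by simp
  qed
  show ?thesis
    using 1 2 3 unfolding Tr_def by (intro exI[of _ d]) blast
qed

text \<open>All conjugates of \<open>x\<close> are roots of one nonzero polynomial over
  \<open>K\<close>. The extension itself may be infinite: this is applied to \<open>S\<close> as
  well as to \<open>L\<close>.\<close>

lemma orbit_finite:
  assumes "galois_extension \<iota>"
  shows "finite {g x | g. g \<in> carrier (gal \<iota>)}"
proof -
  obtain p where p: "p \<noteq> 0" "poly (map_poly \<iota> p) x = 0"
    using assms unfolding galois_extension_def by blast
  interpret K: field_embedding \<iota>
    using assms unfolding galois_extension_def by unfold_locales blast
  have "poly (map_poly \<iota> p) (g x) = 0" if g: "g \<in> carrier (gal \<iota>)" for g
  proof -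
    interpret g: field_embedding g by (rule gal_embedding[OF g])
    have "map_poly g (map_poly \<iota> p) = map_poly \<iota> p"
      by (simp add: map_poly_map_poly o_def galD(3)[OF g])
    then show ?thesis
      using g.poly_map_poly[of "map_poly \<iota> p" x] p(2) by simp
  qed
  then have "{g x | g. g \<in> carrier (gal \<iota>)} \<subseteq> {y. poly (map_poly \<iota> p) y = 0}" by auto
  then show ?thesis
    using poly_roots_finite[of "map_poly \<iota> p"] p(1) K.map_poly_eq_0_iff finite_subset by blast
qed

lemma gal_eq_on_basis:
  assumes \<iota>: "field_extension \<iota>" and B: "finite_basis \<iota> B"
    and f: "field_extension f" "field_extension f'" "\<And>k. f (\<iota> k) = f' (\<iota> k)"
    and eq: "\<And>b. b \<in> B \<Longrightarrow> f b = f' b"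
  shows "f = f'"
proof
  fix x
  interpret K: field_embedding \<iota> by unfold_locales (rule \<iota>)
  interpret f: field_embedding f by unfold_locales (rule f)
  interpret f': field_embedding f' by unfold_locales (rule f)
  have "x \<in> K.span B" "finite B" using B unfolding finite_basis_def by auto
  then obtain u where "x = (\<Sum>b\<in>B. \<iota> (u b) * b)" using K.span_finite by auto
  then show "f x = f' x"
    by (simp add: f.hom_sum f'.hom_sum f(3) eq cong: sum.cong)
qed

text \<open>An automorphism is determined by the images of the basis elements, and each of these
  lies in a finite orbit.\<close>

lemma gal_finite:
  assumes gal: "galois_extension \<iota>" and B: "finite_basis \<iota> B"
  shows "finite (carrier (gal \<iota>))"
proof -
  have \<iota>: "field_extension \<iota>" using gal unfolding galois_extension_def by blast
  have inj: "inj_on (\<lambda>g. restrict g B) (carrier (gal \<iota>))"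
  proof (rule inj_onI)
    fix g h assume g: "g \<in> carrier (gal \<iota>)" and h: "h \<in> carrier (gal \<iota>)"
      and eq: "restrict g B = restrict h B"
    show "g = h"
      using gal_eq_on_basis[OF \<iota> B galD(1)[OF g] galD(1)[OF h]] galD(3)[OF g] galD(3)[OF h] eq
      by (metis restrict_apply')
  qed
  have "(\<lambda>g. restrict g B) ` carrier (gal \<iota>) \<subseteq> (\<Pi>\<^sub>E x\<in>B. {g x | g. g \<in> carrier (gal \<iota>)})"
    by auto
  moreover have "finite (\<Pi>\<^sub>E x\<in>B. {g x | g. g \<in> carrier (gal \<iota>)})"
    using B orbit_finite[OF gal] unfolding finite_basis_def by (intro finite_PiE) auto
  ultimately show ?thesis
    using finite_imageD[OF _ inj] finite_subset by blast
qed

lemma gal_dual_basis: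
  assumes gal: "galois_extension \<iota>" and B: "finite_basis \<iota> B"
  shows "\<exists>d. (\<forall>b\<in>B. \<forall>b'\<in>B. (\<Sum>g\<in>carrier (gal \<iota>). g (d b * b')) = (if b = b' then 1 else 0)) \<and>
    (\<forall>x. (\<Sum>b\<in>B. b * (\<Sum>g\<in>carrier (gal \<iota>). g (d b * x))) = x) \<and>
    (\<forall>g\<in>carrier (gal \<iota>). (\<Sum>b\<in>B. b * g (d b)) = (if g = id then 1 else 0))"
proof (rule dual_basis[OF _ B gal_finite[OF gal B] order.refl _ gal_id])
  show "field_extension \<iota>" using gal unfolding galois_extension_def by blast
  show "g \<circ> h \<in> carrier (gal \<iota>)" if "g \<in> carrier (gal \<iota>)" "h \<in> carrier (gal \<iota>)" for g h
    using that by (rule gal_comp)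
  show "x \<in> range \<iota>" if "\<And>g. g \<in> carrier (gal \<iota>) \<Longrightarrow> g x = x" for x
    using gal that unfolding galois_extension_def by blast
qed

section \<open>Linear categories\<close>

lemma hom_space_simps [simp]:
  "carrier (hom_space C A B) = Hom C A B"
  "monoid.mult (hom_space C A B) = Comp C"
  "one (hom_space C A B) = Ident C A"
  "ring.zero (hom_space C A B) = Zero C A B"
  "add (hom_space C A B) = Add C"
  "module.smult (hom_space C A B) = Scale C"
  by (simp_all add: hom_space_def)

context linear_category
begin

lemma hom_abelian_group: "A \<in> Ob C \<Longrightarrow> B \<in> Ob C \<Longrightarrow> abelian_group (hom_space C A B)"
  using hom_module by (rule Module.module.axioms(2))

lemma hom_finsum_closed:
  assumes "A \<in> Ob C" "B \<in> Ob C" "\<And>i. i \<in> I \<Longrightarrow> u i \<in> Hom C A B"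
  shows "finsum (hom_space C A B) u I \<in> Hom C A B"
proof -
  interpret H: abelian_group "hom_space C A B" by (rule hom_abelian_group[OF assms(1,2)])
  show ?thesis using H.finsum_closed[of u I] assms(3) by auto
qed

lemma zero_in_Hom: "A \<in> Ob C \<Longrightarrow> B \<in> Ob C \<Longrightarrow> Zero C A B \<in> Hom C A B"
  using abelian_monoid.zero_closed[OF abelian_group.axioms(1)[OF hom_abelian_group]] by fastforce

text \<open>The way to see that an additive operation preserves zero: apply it to 0 + 0 = 0. It
  serves for composition, for \<open>f\<close> and for \<open>t\<close>.\<close>

lemma add_eq_self_imp_zero:
  assumes "A \<in> Ob C" "B \<in> Ob C" "u \<in> Hom C A B" "Add C u u = u"
  shows "u = Zero C A B"
proof -
  interpret H: abelian_group "hom_space C A B" by (rule hom_abelian_group[OF assms(1,2)])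
  show ?thesis using H.add.l_cancel_one[of u u] assms(3,4) by simp
qed

lemma comp_zero_left:
  assumes "A \<in> Ob C" "B \<in> Ob C" "D \<in> Ob C" "f \<in> Hom C A B"
  shows "Comp C (Zero C B D) f = Zero C A D"
proof (rule add_eq_self_imp_zero)
  interpret H: abelian_group "hom_space C B D" by (rule hom_abelian_group[OF assms(2,3)])
  have z: "Zero C B D \<in> Hom C B D" by (rule zero_in_Hom[OF assms(2,3)])
  show "Add C (Comp C (Zero C B D) f) (Comp C (Zero C B D) f) = Comp C (Zero C B D) f"
    using comp_add_left[OF assms z z] H.l_zero[of "Zero C B D"] z by simp
  show "Comp C (Zero C B D) f \<in> Hom C A D" by (rule comp_in_Hom[OF assms z])
qed (use assms in auto)

lemma comp_zero_right:
  assumes "A \<in> Ob C" "B \<in> Ob C" "D \<in> Ob C" "g \<in> Hom C B D"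
  shows "Comp C g (Zero C A B) = Zero C A D"
proof (rule add_eq_self_imp_zero)
  interpret H: abelian_group "hom_space C A B" by (rule hom_abelian_group[OF assms(1,2)])
  have z: "Zero C A B \<in> Hom C A B" by (rule zero_in_Hom[OF assms(1,2)])
  show "Add C (Comp C g (Zero C A B)) (Comp C g (Zero C A B)) = Comp C g (Zero C A B)"
    using comp_add_right[OF assms(1-3) z z assms(4)] H.l_zero[of "Zero C A B"] z by simp
  show "Comp C g (Zero C A B) \<in> Hom C A D" by (rule comp_in_Hom[OF assms(1-3) z assms(4)])
qed (use assms in auto)

lemma comp_finsum_left:
  assumes "A \<in> Ob C" "B \<in> Ob C" "D \<in> Ob C" "f \<in> Hom C A B" "finite I"
    and "\<And>i. i \<in> I \<Longrightarrow> u i \<in> Hom C B D"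
  shows "Comp C (finsum (hom_space C B D) u I) f = finsum (hom_space C A D) (\<lambda>i. Comp C (u i) f) I"
  using assms(5,6)
proof (induction I rule: finite_induct)
  case empty
  interpret H: abelian_group "hom_space C B D" by (rule hom_abelian_group[OF assms(2,3)])
  interpret H': abelian_group "hom_space C A D" by (rule hom_abelian_group[OF assms(1,3)])
  show ?case using comp_zero_left[OF assms(1-4)] by simp
next
  case (insert i I)
  interpret H: abelian_group "hom_space C B D" by (rule hom_abelian_group[OF assms(2,3)])
  interpret H': abelian_group "hom_space C A D" by (rule hom_abelian_group[OF assms(1,3)])
  have u: "u i \<in> Hom C B D" "finsum (hom_space C B D) u I \<in> Hom C B D"
    using insert.prems by (auto intro: hom_finsum_closed assms)
  have "Comp C (finsum (hom_space C B D) u (insert i I)) f =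
      Comp C (Add C (u i) (finsum (hom_space C B D) u I)) f"
    using insert.hyps insert.prems by (subst H.finsum_insert) auto
  also have "\<dots> = Add C (Comp C (u i) f) (finsum (hom_space C A D) (\<lambda>i. Comp C (u i) f) I)"
    using comp_add_left[OF assms(1-4) u] insert.IH insert.prems by simp
  also have "\<dots> = finsum (hom_space C A D) (\<lambda>i. Comp C (u i) f) (insert i I)"
    using insert.hyps insert.prems comp_in_Hom[OF assms(1-4)] by (subst H'.finsum_insert) auto
  finally show ?case .
qed

lemma comp_finsum_right:
  assumes "A \<in> Ob C" "B \<in> Ob C" "D \<in> Ob C" "g \<in> Hom C B D" "finite I"
    and "\<And>i. i \<in> I \<Longrightarrow> u i \<in> Hom C A B"
  shows "Comp C g (finsum (hom_space C A B) u I) = finsum (hom_space C A D) (\<lambda>i. Comp C g (u i)) I"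
  using assms(5,6)
proof (induction I rule: finite_induct)
  case empty
  interpret H: abelian_group "hom_space C A B" by (rule hom_abelian_group[OF assms(1,2)])
  interpret H': abelian_group "hom_space C A D" by (rule hom_abelian_group[OF assms(1,3)])
  show ?case using comp_zero_right[OF assms(1-4)] by simp
next
  case (insert i I)
  interpret H: abelian_group "hom_space C A B" by (rule hom_abelian_group[OF assms(1,2)])
  interpret H': abelian_group "hom_space C A D" by (rule hom_abelian_group[OF assms(1,3)])
  have u: "u i \<in> Hom C A B" "finsum (hom_space C A B) u I \<in> Hom C A B"
    using insert.prems by (auto intro: hom_finsum_closed assms)
  have "Comp C g (finsum (hom_space C A B) u (insert i I)) =
      Comp C g (Add C (u i) (finsum (hom_space C A B) u I))"
    using insert.hyps insert.prems by (subst H.finsum_insert) auto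
  also have "\<dots> = Add C (Comp C g (u i)) (finsum (hom_space C A D) (\<lambda>i. Comp C g (u i)) I)"
    using comp_add_right[OF assms(1-3) u assms(4)] insert.IH insert.prems by simp
  also have "\<dots> = finsum (hom_space C A D) (\<lambda>i. Comp C g (u i)) (insert i I)"
    using insert.hyps insert.prems comp_in_Hom[OF assms(1-3) _ assms(4)] by (subst H'.finsum_insert) auto
  finally show ?case .
qed

lemma comp_minus_left:
  assumes "A \<in> Ob C" "B \<in> Ob C" "D \<in> Ob C" "f \<in> Hom C A B" "u \<in> Hom C B D" "v \<in> Hom C B D"
  shows "Comp C (u \<ominus>\<^bsub>hom_space C B D\<^esub> v) f = Comp C u f \<ominus>\<^bsub>hom_space C A D\<^esub> Comp C v f"
proof -
  interpret H: abelian_group "hom_space C B D" by (rule hom_abelian_group[OF assms(2,3)])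
  interpret H': abelian_group "hom_space C A D" by (rule hom_abelian_group[OF assms(1,3)])
  let ?v = "\<ominus>\<^bsub>hom_space C B D\<^esub> v"
  have v: "?v \<in> Hom C B D" using H.a_inv_closed[of v] assms(6) by simp
  have c: "Comp C ?v f \<in> Hom C A D" "Comp C v f \<in> Hom C A D" "Comp C u f \<in> Hom C A D"
    using comp_in_Hom[OF assms(1-4)] v assms(5,6) by blast+
  have "Add C (Comp C ?v f) (Comp C v f) = Zero C A D"
    using comp_add_left[OF assms(1-4) v assms(6)] H.l_neg[of v] assms(6) comp_zero_left[OF assms(1-4)] by simp
  then have "\<ominus>\<^bsub>hom_space C A D\<^esub> Comp C v f = Comp C ?v f"
    using H'.minus_equality[of "Comp C ?v f" "Comp C v f"] c by simp
  then show ?thesis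
    using comp_add_left[OF assms(1-5) v] by (simp add: a_minus_def)
qed

text \<open>The image of an idempotent \<open>e\<close> is the kernel of \<open>1 - e\<close>.\<close>

lemma idempotent_splits:
  assumes A: "A \<in> Ob C" and e: "e \<in> Hom C A A" "Comp C e e = e"
    and kernels: "\<And>f. f \<in> Hom C A A \<Longrightarrow> \<exists>N i. kernel_of C A A f N i"
  obtains N i p where "N \<in> Ob C" "i \<in> Hom C N A" "p \<in> Hom C A N"
    "Comp C i p = e" "Comp C p i = Ident C N"
proof -
  interpret H: abelian_group "hom_space C A A" by (rule hom_abelian_group[OF A A])
  let ?q = "Ident C A \<ominus>\<^bsub>hom_space C A A\<^esub> e"
  have one: "Ident C A \<in> Hom C A A" by (rule ident_in_Hom[OF A])
  have q: "?q \<in> Hom C A A" using H.minus_closed[of "Ident C A" e] one e by simp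
  have q_iff: "Comp C ?q h = Zero C Y A \<longleftrightarrow> Comp C e h = h" if Y: "Y \<in> Ob C" "h \<in> Hom C Y A" for Y h
  proof -
    interpret H': abelian_group "hom_space C Y A" by (rule hom_abelian_group[OF Y(1) A])
    have "Comp C e h \<in> Hom C Y A" by (rule comp_in_Hom[OF Y(1) A A Y(2) e(1)])
    then have "h \<ominus>\<^bsub>hom_space C Y A\<^esub> Comp C e h = Zero C Y A \<longleftrightarrow> Comp C e h = h"
      using H'.minus_equality[of h "\<ominus>\<^bsub>hom_space C Y A\<^esub> Comp C e h"] H'.minus_minus[of "Comp C e h"]
        H'.a_inv_closed[of "Comp C e h"] H'.r_neg[of h] Y(2)
      by (auto simp: a_minus_def)
    then show ?thesis
      using comp_minus_left[OF Y(1) A A Y(2) one e(1)] comp_ident_left[OF Y(1) A Y(2)] by simp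
  qed
  obtain N i where k: "kernel_of C A A ?q N i" using kernels[OF q] by blast
  then have N: "N \<in> Ob C" and i: "i \<in> Hom C N A" and qi: "Comp C ?q i = Zero C N A"
    and univ: "\<And>Y h. Y \<in> Ob C \<Longrightarrow> h \<in> Hom C Y A \<Longrightarrow> Comp C ?q h = Zero C Y A \<Longrightarrow>
      \<exists>!u. u \<in> Hom C Y N \<and> Comp C i u = h"
    unfolding kernel_of_def by blast+
  \<comment> \<open>Idempotency says that \<open>1 - e\<close> kills \<open>e\<close>, so
    \<open>e\<close> factors through the kernel.\<close>
  obtain p where p: "p \<in> Hom C A N" "Comp C i p = e"
    using univ[OF A e(1)] q_iff[OF A e(1)] e(2) by blast
  have ei: "Comp C e i = i" using q_iff[OF N i] qi by blast
  \<comment> \<open>Both \<open>Comp C p i\<close> and the identity of \<open>N\<close> factor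
    \<open>i\<close> through the kernel, so they agree by uniqueness of factorisations.\<close>
  have "Comp C i (Comp C p i) = i"
    using comp_assoc[OF N A N A i p(1) i] p(2) ei by simp
  moreover have "Comp C p i \<in> Hom C N N" by (rule comp_in_Hom[OF N A N i p(1)])
  moreover have "Ident C N \<in> Hom C N N" "Comp C i (Ident C N) = i"
    using ident_in_Hom[OF N] comp_ident_right[OF N A i] by blast+
  ultimately have "Comp C p i = Ident C N"
    using univ[OF N i qi] by blast
  then show thesis using that N i p by blast
qed

text \<open>Composing \<open>w\<close> with the decomposition of the identity of \<open>P\<close>
  writes it as the sum of the arrows \<open>Comp C (Comp C w (inc i)) (prj i)\<close>, which see
  only the restrictions of \<open>w\<close> to the summands.\<close>

lemma direct_sum_eqI:
  assumes "direct_sum C I A P inc prj" and A: "\<And>i. i \<in> I \<Longrightarrow> A i \<in> Ob C"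
    and Y: "Y \<in> Ob C" "u \<in> Hom C P Y" "v \<in> Hom C P Y"
    and eq: "\<And>i. i \<in> I \<Longrightarrow> Comp C u (inc i) = Comp C v (inc i)"
  shows "u = v"
proof -
  have fin: "finite I" and P: "P \<in> Ob C"
    and inc: "\<And>i. i \<in> I \<Longrightarrow> inc i \<in> Hom C (A i) P" and prj: "\<And>i. i \<in> I \<Longrightarrow> prj i \<in> Hom C P (A i)"
    and one: "finsum (hom_space C P P) (\<lambda>i. Comp C (inc i) (prj i)) I = Ident C P"
    using assms(1) unfolding direct_sum_def by auto
  interpret H: abelian_group "hom_space C P Y" by (rule hom_abelian_group[OF P Y(1)])
  have ip: "Comp C (inc i) (prj i) \<in> Hom C P P" if "i \<in> I" for i
    by (rule comp_in_Hom[OF P A[OF that] P prj[OF that] inc[OF that]])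
  have "w = finsum (hom_space C P Y) (\<lambda>i. Comp C (Comp C w (inc i)) (prj i)) I"
    if w: "w \<in> Hom C P Y" for w
  proof -
    have "w = Comp C w (finsum (hom_space C P P) (\<lambda>i. Comp C (inc i) (prj i)) I)"
      using comp_ident_right[OF P Y(1) w] one by simp
    also have "\<dots> = finsum (hom_space C P Y) (\<lambda>i. Comp C w (Comp C (inc i) (prj i))) I"
      by (rule comp_finsum_right[OF P P Y(1) w fin ip])
    also have "\<dots> = finsum (hom_space C P Y) (\<lambda>i. Comp C (Comp C w (inc i)) (prj i)) I"
    proof (rule H.finsum_cong'[OF refl])
      show "Comp C w (Comp C (inc i) (prj i)) = Comp C (Comp C w (inc i)) (prj i)" if "i \<in> I" for i
        by (rule comp_assoc[OF P A[OF that] P Y(1) prj[OF that] inc[OF that] w])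
      show "(\<lambda>i. Comp C (Comp C w (inc i)) (prj i)) \<in> I \<rightarrow> carrier (hom_space C P Y)"
        using comp_in_Hom[OF P A Y(1) prj comp_in_Hom[OF A P Y(1) inc w]] by auto
    qed
    finally show ?thesis .
  qed
  moreover have "finsum (hom_space C P Y) (\<lambda>i. Comp C (Comp C u (inc i)) (prj i)) I =
      finsum (hom_space C P Y) (\<lambda>i. Comp C (Comp C v (inc i)) (prj i)) I"
    using comp_in_Hom[OF P A Y(1) prj comp_in_Hom[OF A P Y(1) inc Y(3)]]
    by (intro H.finsum_cong') (auto simp: eq)
  ultimately show ?thesis using Y(2,3) by metis
qed

text \<open>The arrow is the sum of the \<open>Comp C (u i) (prj i)\<close>; after composition with
  \<open>inc i\<close>, orthogonality leaves one term.\<close>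

lemma direct_sum_copair:
  assumes "direct_sum C I A P inc prj" and A: "\<And>i. i \<in> I \<Longrightarrow> A i \<in> Ob C"
    and Y: "Y \<in> Ob C" and u: "\<And>i. i \<in> I \<Longrightarrow> u i \<in> Hom C (A i) Y"
  obtains w where "w \<in> Hom C P Y" "\<And>i. i \<in> I \<Longrightarrow> Comp C w (inc i) = u i"
proof -
  have fin: "finite I" and P: "P \<in> Ob C"
    and inc: "\<And>i. i \<in> I \<Longrightarrow> inc i \<in> Hom C (A i) P" and prj: "\<And>i. i \<in> I \<Longrightarrow> prj i \<in> Hom C P (A i)"
    and orth: "\<And>i i'. i \<in> I \<Longrightarrow> i' \<in> I \<Longrightarrow>
      Comp C (prj i') (inc i) = (if i' = i then Ident C (A i) else Zero C (A i) (A i'))"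
    using assms(1) unfolding direct_sum_def by auto
  let ?w = "finsum (hom_space C P Y) (\<lambda>i. Comp C (u i) (prj i)) I"
  have up: "Comp C (u i) (prj i) \<in> Hom C P Y" if "i \<in> I" for i
    by (rule comp_in_Hom[OF P A[OF that] Y prj[OF that] u[OF that]])
  have w: "?w \<in> Hom C P Y" by (rule hom_finsum_closed[OF P Y up])
  have "Comp C ?w (inc i) = u i" if i: "i \<in> I" for i
  proof -
    interpret H: abelian_group "hom_space C (A i) Y" by (rule hom_abelian_group[OF A[OF i] Y])
    have "Comp C ?w (inc i) = finsum (hom_space C (A i) Y) (\<lambda>i'. Comp C (Comp C (u i') (prj i')) (inc i)) I"
      by (rule comp_finsum_left[OF A[OF i] P Y inc[OF i] fin up])
    also have "\<dots> = finsum (hom_space C (A i) Y) (\<lambda>i'. if i = i' then u i else \<zero>\<^bsub>hom_space C (A i) Y\<^esub>) I"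
    proof (rule H.finsum_cong'[OF refl])
      show "(\<lambda>i'. if i = i' then u i else \<zero>\<^bsub>hom_space C (A i) Y\<^esub>) \<in> I \<rightarrow> carrier (hom_space C (A i) Y)"
        using u zero_in_Hom[OF A[OF i] Y] by auto
      fix i' assume i': "i' \<in> I"
      have "Comp C (Comp C (u i') (prj i')) (inc i) = Comp C (u i') (Comp C (prj i') (inc i))"
        by (rule comp_assoc[OF A[OF i] P A[OF i'] Y inc[OF i] prj[OF i'] u[OF i'], symmetric])
      then show "Comp C (Comp C (u i') (prj i')) (inc i) = (if i = i' then u i else \<zero>\<^bsub>hom_space C (A i) Y\<^esub>)"
        using orth[OF i i'] comp_ident_right[OF A[OF i] Y u[OF i]]
          comp_zero_right[OF A[OF i] A[OF i'] Y u[OF i']] by auto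
    qed
    also have "\<dots> = u i"
      using H.add.finprod_singleton[OF i fin, of "\<lambda>_. u i"] u[OF i] by simp
    finally show ?thesis .
  qed
  then show thesis using that w by blast
qed

end

section \<open>Galois descent\<close>

lemma (in abelian_group) finsum_swap:
  assumes "finite I" "finite J" "\<And>i j. i \<in> I \<Longrightarrow> j \<in> J \<Longrightarrow> u i j \<in> carrier G"
  shows "(\<Oplus>i\<in>I. \<Oplus>j\<in>J. u i j) = (\<Oplus>j\<in>J. \<Oplus>i\<in>I. u i j)"
  using assms(1,3)
proof (induction I rule: finite_induct)
  case empty
  then show ?case by simp
next
  case (insert k I)
  have "(\<Oplus>i\<in>insert k I. \<Oplus>j\<in>J. u i j) = (\<Oplus>j\<in>J. u k j) \<oplus> (\<Oplus>j\<in>J. \<Oplus>i\<in>I. u i j)"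
    using insert by (subst finsum_insert) auto
  also have "\<dots> = (\<Oplus>j\<in>J. u k j \<oplus> (\<Oplus>i\<in>I. u i j))"
    using insert.prems by (intro finsum_addf[symmetric]) auto
  also have "\<dots> = (\<Oplus>j\<in>J. \<Oplus>i\<in>insert k I. u i j)"
    using insert.prems insert.hyps by (intro finsum_cong') auto
  finally show ?case .
qed

text \<open>The object is split into its underlying object \<open>N0\<close> and its structure map
  \<open>f\<close>. Arrows to twists of it are elements of \<open>E\<close>, so the arguments below
  become computations in a single ring.\<close>

locale galois_module = abelian_linear_category C
  for C :: "('k::field, 'o, 'm) lincat" +
  fixes \<iota> :: "'k \<Rightarrow> 'l::field" and B :: "'l set" and N0 :: 'o and f :: "'l \<Rightarrow> 'm"
  assumes gal: "galois_extension \<iota>" and basis: "finite_basis \<iota> B"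
    and M: "(N0, f) \<in> Ob (base_change \<iota> C)"
begin

abbreviation G where "G \<equiv> carrier (gal \<iota>)"
abbreviation E where "E \<equiv> Hom C N0 N0"
abbreviation comp (infixr \<open>\<star>\<close> 70) where "u \<star> v \<equiv> Comp C u v"

lemma N0: "N0 \<in> Ob C"
  using M by (simp add: base_change_def)

lemma f_in [simp]: "f x \<in> E"
  and f_one: "f 1 = Ident C N0"
  and f_add: "f (x + y) = Add C (f x) (f y)"
  and f_mult: "f (x * y) = f x \<star> f y"
  and f_scale: "f (\<iota> k * x) = Scale C k (f x)"
  using M by (auto simp: base_change_def ring_hom_def ring_of_type_algebra_def)

lemma E_comp [simp]: "u \<in> E \<Longrightarrow> v \<in> E \<Longrightarrow> u \<star> v \<in> E"
  using comp_in_Hom[OF N0 N0 N0] by blast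

lemma E_assoc: "u \<in> E \<Longrightarrow> v \<in> E \<Longrightarrow> w \<in> E \<Longrightarrow> (u \<star> v) \<star> w = u \<star> v \<star> w"
  using comp_assoc[OF N0 N0 N0 N0] by simp

lemma E_ident [simp]: "Ident C N0 \<in> E" "u \<in> E \<Longrightarrow> Ident C N0 \<star> u = u" "u \<in> E \<Longrightarrow> u \<star> Ident C N0 = u"
  using ident_in_Hom[OF N0] comp_ident_left[OF N0 N0] comp_ident_right[OF N0 N0] by blast+

sublocale E: abelian_group "hom_space C N0 N0"
  by (rule hom_abelian_group[OF N0 N0])

lemma f_zero: "f 0 = Zero C N0 N0"
  using add_eq_self_imp_zero[OF N0 N0 f_in, of 0] f_add[of 0 0] by simp

lemma E_zero [simp]: "Zero C N0 N0 \<in> E" "u \<in> E \<Longrightarrow> Zero C N0 N0 \<star> u = Zero C N0 N0"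
  "u \<in> E \<Longrightarrow> u \<star> Zero C N0 N0 = Zero C N0 N0"
  using zero_in_Hom[OF N0 N0] comp_zero_left[OF N0 N0 N0] comp_zero_right[OF N0 N0 N0] by blast+

lemma f_sum: "f (sum u I) = finsum (hom_space C N0 N0) (\<lambda>i. f (u i)) I" if "finite I"
  using that by (induction I rule: finite_induct) (auto simp: f_zero f_add)

abbreviation gsum where "gsum \<equiv> finsum (hom_space C N0 N0)"

lemma gsum_in [simp]: "(\<And>i. i \<in> I \<Longrightarrow> u i \<in> E) \<Longrightarrow> gsum u I \<in> E"
  by (rule hom_finsum_closed[OF N0 N0])

lemma gsum_comp_left: "finite I \<Longrightarrow> (\<And>i. i \<in> I \<Longrightarrow> u i \<in> E) \<Longrightarrow> w \<in> E \<Longrightarrow> gsum u I \<star> w = gsum (\<lambda>i. u i \<star> w) I"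
  by (rule comp_finsum_left[OF N0 N0 N0])

lemma gsum_comp_right: "finite I \<Longrightarrow> (\<And>i. i \<in> I \<Longrightarrow> u i \<in> E) \<Longrightarrow> w \<in> E \<Longrightarrow> w \<star> gsum u I = gsum (\<lambda>i. w \<star> u i) I"
  by (rule comp_finsum_right[OF N0 N0 N0])

lemma gsum_cong: "(\<And>i. i \<in> I \<Longrightarrow> u i = v i) \<Longrightarrow> (\<And>i. i \<in> I \<Longrightarrow> v i \<in> E) \<Longrightarrow> gsum u I = gsum v I"
  by (rule E.finsum_cong') auto

lemma finite_G: "finite G"
  by (rule gal_finite[OF gal basis])

lemma ext_\<iota>: "field_extension \<iota>"
  using gal unfolding galois_extension_def by blast

sublocale \<iota>: field_embedding \<iota> by unfold_locales (rule ext_\<iota>)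

text \<open>
  The order of composition is reversed because \<open>c g\<close> is an isomorphism from \<open>M\<close> to \<open>twist g M\<close>,
  that is, it is semilinear for \<open>inv g\<close>.
\<close>

definition descent_datum :: "(('l \<Rightarrow> 'l) \<Rightarrow> 'm) \<Rightarrow> bool" where
  "descent_datum c \<longleftrightarrow> (\<forall>g\<in>G. c g \<in> E \<and> (\<forall>x. c g \<star> f (g x) = f x \<star> c g)) \<and>
     (\<forall>g\<in>G. \<forall>h\<in>G. c h \<star> c g = c (g \<circ> h)) \<and> c id = Ident C N0"

text \<open>Classical Galois descent without elements: \<open>N\<close> plays the role of the
  invariants of the \<open>c g\<close>, \<open>T\<close> that of the trace, \<open>t x\<close>
  multiplies an invariant by \<open>x\<close>, and \<open>prj b\<close> extracts the coordinate at
  \<open>b\<close> as the trace of \<open>d b\<close> times the argument. The dual basis identities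
  then become the two identities of a direct sum.\<close>

lemma descent_datum_induced:
  assumes "descent_datum c"
  shows "\<exists>N\<in>Ob C. is_induced \<iota> C N (N0, f)"
proof -
  have c: "\<And>g. g \<in> G \<Longrightarrow> c g \<in> E" and semi: "\<And>g x. g \<in> G \<Longrightarrow> c g \<star> f (g x) = f x \<star> c g"
    and comp: "\<And>g h. g \<in> G \<Longrightarrow> h \<in> G \<Longrightarrow> c h \<star> c g = c (g \<circ> h)" and c_id: "c id = Ident C N0"
    using assms unfolding descent_datum_def by blast+
  have finB: "finite B" using basis unfolding finite_basis_def by blast
  obtain d where d: "\<forall>b\<in>B. \<forall>b'\<in>B. (\<Sum>g\<in>G. g (d b * b')) = (if b = b' then 1 else 0)"
    "\<forall>x. (\<Sum>b\<in>B. b * (\<Sum>g\<in>G. g (d b * x))) = x"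
    "\<forall>g\<in>G. (\<Sum>b\<in>B. b * g (d b)) = (if g = id then 1 else 0)"
    using gal_dual_basis[OF gal basis] by blast
  note dual = d(1)[rule_format] and expand = d(2)[rule_format] and delta = d(3)[rule_format]
  have "B \<noteq> {}" using expand[of 1] by auto
  then obtain b0 where "b0 \<in> B" by blast
  \<comment> \<open>Duality of \<open>b0\<close> with itself says precisely that this product has
    trace 1.\<close>
  define a where "a = d b0 * b0"
  have Tr_a: "(\<Sum>g\<in>G. g a) = 1" using dual \<open>b0 \<in> B\<close> unfolding a_def by simp
  define T where "T = gsum c G"
  have T[simp]: "T \<in> E" unfolding T_def using c by simp
  have Tc: "T \<star> c g = T" if g: "g \<in> G" for g
  proof -
    have "T \<star> c g = gsum (\<lambda>h. c (g \<circ> h)) G"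
      unfolding T_def using finite_G c comp[OF g] c[OF gal_comp[OF g]] c[OF g]
      by (subst gsum_comp_left) (auto intro!: gsum_cong)
    also have "\<dots> = gsum c ((\<circ>) g ` G)"
      using gal_comp_bij[OF g] c by (subst E.finsum_reindex) (auto simp: bij_betw_def)
    also have "\<dots> = T" using gal_comp_bij[OF g] by (simp add: T_def bij_betw_def)
    finally show ?thesis .
  qed
  \<comment> \<open>Expand the right-hand \<open>T\<close>; semilinearity moves each
    \<open>c g\<close> to the left past the scalar, turning \<open>x\<close> into
    \<open>g x\<close>, and there it is absorbed by \<open>T\<close>. With trace 1 this makes
    \<open>e\<close> idempotent.\<close>
  have TfT: "T \<star> f x \<star> T = T \<star> f (\<Sum>g\<in>G. g x)" for x
  proof -
    have "T \<star> f x \<star> T = gsum (\<lambda>g. T \<star> f x \<star> c g) G"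
    proof -
      have "f x \<star> T = gsum (\<lambda>g. f x \<star> c g) G"
        unfolding T_def using finite_G c by (intro gsum_comp_right) auto
      moreover have "T \<star> gsum (\<lambda>g. f x \<star> c g) G = gsum (\<lambda>g. T \<star> f x \<star> c g) G"
        using finite_G c by (intro gsum_comp_right) auto
      ultimately show ?thesis by simp
    qed
    also have "\<dots> = gsum (\<lambda>g. T \<star> f (g x)) G"
    proof (rule gsum_cong)
      fix g assume g: "g \<in> G"
      have "T \<star> f x \<star> c g = T \<star> c g \<star> f (g x)" using semi[OF g] by simp
      also have "\<dots> = (T \<star> c g) \<star> f (g x)" using c[OF g] by (simp add: E_assoc)
      finally show "T \<star> f x \<star> c g = T \<star> f (g x)" using Tc[OF g] by simp
    qed simp
    also have "\<dots> = T \<star> f (\<Sum>g\<in>G. g x)"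
      using finite_G by (subst gsum_comp_right[symmetric]) (auto simp: f_sum)
    finally show ?thesis .
  qed
  define e where "e = T \<star> f a"
  have e: "e \<in> E" unfolding e_def by simp
  have TfaT: "T \<star> f a \<star> T = T" using TfT[of a] Tr_a by (simp add: f_one)
  then have eT: "e \<star> T = T" unfolding e_def by (simp add: E_assoc)
  have "e \<star> e = (e \<star> T) \<star> f a" unfolding e_def by (simp add: E_assoc)
  then have ee: "e \<star> e = e" using eT by (simp add: e_def)
  obtain N i p where N: "N \<in> Ob C" and i: "i \<in> Hom C N N0" and p: "p \<in> Hom C N0 N"
    and ip: "i \<star> p = e" and pi: "p \<star> i = Ident C N"
    using idempotent_splits[OF N0 e ee] has_kernels[OF N0 N0] by metis
  have i_comp: "u \<star> i \<in> Hom C N N0" if "u \<in> E" for u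
    using comp_in_Hom[OF N N0 N0 i that] .
  have p_comp: "p \<star> u \<in> Hom C N0 N" if "u \<in> E" for u
    using comp_in_Hom[OF N0 N0 N that p] .
  have ei: "e \<star> i = i"
    using comp_assoc[OF N N0 N N0 i p i] ip pi comp_ident_right[OF N N0 i] by simp
  define t where "t x = f x \<star> i" for x
  define prj where "prj b = p \<star> T \<star> f (d b)" for b
  have t_in: "t x \<in> Hom C N N0" for x unfolding t_def by (rule i_comp) simp
  have prj_in: "prj b \<in> Hom C N0 N" for b unfolding prj_def by (rule p_comp) simp
  have prj_t: "prj b' \<star> t b = (if b' = b then Ident C N else Zero C N N)" if b: "b \<in> B" "b' \<in> B" for b b'
  proof -
    let ?x = "d b' * b" and ?\<delta> = "if b' = b then 1 else 0"
    have "prj b' \<star> t b = ((p \<star> T \<star> f (d b')) \<star> f b) \<star> i"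
      unfolding prj_def t_def by (rule comp_assoc[OF N N0 N0 N i]) (auto intro: p_comp)
    also have "(p \<star> T \<star> f (d b')) \<star> f b = p \<star> (T \<star> f (d b')) \<star> f b"
      by (rule comp_assoc[OF N0 N0 N0 N, symmetric]) (auto intro: p)
    also have "(T \<star> f (d b')) \<star> f b = T \<star> f ?x" by (simp add: E_assoc f_mult)
    also have "(p \<star> T \<star> f ?x) \<star> i = p \<star> (T \<star> f ?x) \<star> i"
      by (rule comp_assoc[OF N N0 N0 N i _ p, symmetric]) simp
    \<comment> \<open>Inserting \<open>e\<close>, which acts as the identity on its image, produces
      a second \<open>T\<close>, so that \<open>TfT\<close> turns the scalar into its trace, which
      is 0 or 1 by duality.\<close>
    also have "(T \<star> f ?x) \<star> i = (T \<star> f ?x) \<star> e \<star> i" by (simp add: ei)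
    also have "\<dots> = ((T \<star> f ?x) \<star> e) \<star> i"
      by (rule comp_assoc[OF N N0 N0 N0 i e]) simp
    also have "(T \<star> f ?x) \<star> e = (T \<star> f ?x \<star> T) \<star> f a" by (simp add: e_def E_assoc)
    also have "\<dots> = (T \<star> f ?\<delta>) \<star> f a" unfolding TfT using dual[OF b(2,1)] by simp
    also have "\<dots> = (if b' = b then e else Zero C N0 N0)"
      by (simp add: f_one f_zero e_def)
    also have "p \<star> (if b' = b then e else Zero C N0 N0) \<star> i = (if b' = b then Ident C N else Zero C N N)"
      by (simp add: ei pi comp_zero_left[OF N N0 N0 i] comp_zero_right[OF N N0 N p])
    finally show ?thesis .
  qed
  have "gsum (\<lambda>b. t b \<star> prj b) B = Ident C N0"
  proof -
    \<comment> \<open>Each summand is written as a combination of the \<open>c g\<close> with scalar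
      coefficients on the left. After exchanging the sums, the coefficient of \<open>c g\<close> is
      the sum of \<open>b * inv_into UNIV g (d b)\<close> over the basis, which by
      \<open>delta\<close> is 1 for the identity and 0 otherwise.\<close>
    have tp: "t b \<star> prj b = gsum (\<lambda>g. f (b * inv_into UNIV g (d b)) \<star> c g) G" for b
    proof -
      have "t b \<star> prj b = ((f b \<star> i) \<star> p) \<star> T \<star> f (d b)"
        unfolding t_def prj_def by (rule comp_assoc[OF N0 N0 N N0 _ p i_comp]) simp_all
      also have "(f b \<star> i) \<star> p = f b \<star> i \<star> p"
        by (rule comp_assoc[OF N0 N N0 N0 p i, symmetric]) simp
      also have "(f b \<star> i \<star> p) \<star> T \<star> f (d b) = f b \<star> (e \<star> T) \<star> f (d b)"
        by (simp add: ip e E_assoc)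
      also have "\<dots> = f b \<star> T \<star> f (d b)" by (simp add: eT)
      also have "T \<star> f (d b) = gsum (\<lambda>g. c g \<star> f (d b)) G"
        unfolding T_def using finite_G c by (intro gsum_comp_left) auto
      also have "f b \<star> \<dots> = gsum (\<lambda>g. f b \<star> c g \<star> f (d b)) G"
        using finite_G c by (intro gsum_comp_right) auto
      also have "\<dots> = gsum (\<lambda>g. f (b * inv_into UNIV g (d b)) \<star> c g) G"
      proof (rule gsum_cong)
        fix g assume g: "g \<in> G"
        have "c g \<star> f (d b) = f (inv_into UNIV g (d b)) \<star> c g"
          using semi[OF g, of "inv_into UNIV g (d b)"] gal_inv_app(2)[OF g] by simp
        then show "f b \<star> c g \<star> f (d b) = f (b * inv_into UNIV g (d b)) \<star> c g"
          using c[OF g] by (simp add: f_mult E_assoc)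
      qed (use c in auto)
      finally show ?thesis .
    qed
    have "gsum (\<lambda>b. t b \<star> prj b) B = gsum (\<lambda>b. gsum (\<lambda>g. f (b * inv_into UNIV g (d b)) \<star> c g) G) B"
      unfolding tp ..
    also have "\<dots> = gsum (\<lambda>g. gsum (\<lambda>b. f (b * inv_into UNIV g (d b)) \<star> c g) B) G"
      using E.finsum_swap[OF finB finite_G] c by simp
    also have "\<dots> = gsum (\<lambda>g. if id = g then c g else \<zero>\<^bsub>hom_space C N0 N0\<^esub>) G"
    proof (rule gsum_cong)
      fix g assume g: "g \<in> G"
      have "gsum (\<lambda>b. f (b * inv_into UNIV g (d b)) \<star> c g) B = f (\<Sum>b\<in>B. b * inv_into UNIV g (d b)) \<star> c g"
        using finB c[OF g] by (subst gsum_comp_left[symmetric]) (auto simp: f_sum)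
      also have "inv_into UNIV g = id \<longleftrightarrow> g = id"
        using gal_inv_app[OF g] by (auto simp: fun_eq_iff)
      then have "f (\<Sum>b\<in>B. b * inv_into UNIV g (d b)) \<star> c g = (if id = g then c g else \<zero>\<^bsub>hom_space C N0 N0\<^esub>)"
        using delta[OF gal_inv[OF g]] c[OF g] by (auto simp: f_one f_zero)
      finally show "gsum (\<lambda>b. f (b * inv_into UNIV g (d b)) \<star> c g) B = (if id = g then c g else \<zero>\<^bsub>hom_space C N0 N0\<^esub>)" .
    qed (use c in auto)
    also have "\<dots> = c id"
      using c by (intro E.add.finprod_singleton[OF gal_id finite_G, of c]) auto
    finally show ?thesis by (simp add: c_id)
  qed
  then have ds: "direct_sum C B (\<lambda>_. N) N0 t prj"
    unfolding direct_sum_def using finB N0 t_in prj_in prj_t by auto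
  have "t (x + y) = Add C (t x) (t y)" for x y
    unfolding t_def f_add using comp_add_left[OF N N0 N0 i f_in f_in] by simp
  moreover have "t (\<iota> k * x) = Scale C k (t x)" for k x
    unfolding t_def f_scale using comp_scale_left[OF N N0 N0 i f_in] by simp
  moreover have "f x \<star> t y = t (x * y)" for x y
    unfolding t_def f_mult by (rule comp_assoc[OF N N0 N0 N0 i f_in f_in])
  ultimately have "is_induced \<iota> C N (N0, f)"
    unfolding is_induced_def using M basis t_in ds by auto
  then show ?thesis using N by blast
qed

end

section \<open>Semilinear automorphisms of induced objects and their transport\<close>

lemma base_change_simps [simp]:
  "Hom (base_change \<iota> C) (A, f) (A', f') = {\<phi> \<in> Hom C A A'. \<forall>x. Comp C \<phi> (f x) = Comp C (f' x) \<phi>}"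
  "Comp (base_change \<iota> C) = Comp C"
  "Ident (base_change \<iota> C) (A, f) = Ident C A"
  by (simp_all add: base_change_def)

lemma base_change_ObD:
  assumes "(A, f) \<in> Ob (base_change \<iota> C)"
  shows "A \<in> Ob C" "f x \<in> Hom C A A"
  using assms by (auto simp: base_change_def ring_hom_def ring_of_type_algebra_def)

context linear_category
begin

lemma conjugate_comp:
  assumes A: "A \<in> Ob C" and P: "P \<in> Ob C" and \<phi>: "\<phi> \<in> Hom C A P" and \<psi>: "\<psi> \<in> Hom C P A"
    and \<phi>\<psi>: "Comp C \<phi> \<psi> = Ident C P" and u: "u \<in> Hom C P P" and v: "v \<in> Hom C P P"
  shows "Comp C (Comp C \<psi> (Comp C u \<phi>)) (Comp C \<psi> (Comp C v \<phi>)) = Comp C \<psi> (Comp C (Comp C u v) \<phi>)"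
proof -
  have v\<phi>: "Comp C v \<phi> \<in> Hom C A P" by (rule comp_in_Hom[OF A P P \<phi> v])
  have u\<phi>: "Comp C u \<phi> \<in> Hom C A P" by (rule comp_in_Hom[OF A P P \<phi> u])
  have w: "Comp C \<psi> (Comp C v \<phi>) \<in> Hom C A A" by (rule comp_in_Hom[OF A P A v\<phi> \<psi>])
  have "Comp C \<phi> (Comp C \<psi> (Comp C v \<phi>)) = Comp C v \<phi>"
    using comp_assoc[OF A P A P v\<phi> \<psi> \<phi>] \<phi>\<psi> comp_ident_left[OF A P v\<phi>] by simp
  then have "Comp C (Comp C u \<phi>) (Comp C \<psi> (Comp C v \<phi>)) = Comp C (Comp C u v) \<phi>"
    using comp_assoc[OF A A P P w \<phi> u] comp_assoc[OF A P P P \<phi> v u] by simp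
  then show ?thesis
    using comp_assoc[OF A A P A w u\<phi> \<psi>] by simp
qed

text \<open>Evaluates the definite description: a left inverse \<open>w\<close> equals
  \<open>w (u v) = (w u) v = v\<close>.\<close>

lemma inverse_arrow_eq:
  assumes A: "(A, f) \<in> Ob (base_change \<iota> C)" and A': "A' \<in> Ob C"
    and inv: "inverse_pair (base_change \<iota> C) (A, f) (A', f') u v"
  shows "inverse_arrow (base_change \<iota> C) (A, f) (A', f') u = v"
  unfolding inverse_arrow_def
proof (rule the_equality[where P = "inverse_pair (base_change \<iota> C) (A, f) (A', f') u"])
  fix w assume "inverse_pair (base_change \<iota> C) (A, f) (A', f') u w"
  then have w: "w \<in> Hom C A' A" "Comp C w u = Ident C A"
    by (simp_all add: inverse_pair_def)
  have uv: "u \<in> Hom C A A'" "v \<in> Hom C A' A" "Comp C u v = Ident C A'"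
    using inv by (simp_all add: inverse_pair_def)
  note AO = base_change_ObD(1)[OF A]
  have "w = Comp C w (Comp C u v)" using comp_ident_right[OF A' AO w(1)] uv(3) by simp
  also have "\<dots> = Comp C (Comp C w u) v" by (rule comp_assoc[OF A' AO A' AO uv(2,1) w(1)])
  also have "\<dots> = v" using comp_ident_left[OF A' AO uv(2)] w(2) by simp
  finally show "w = v" .
qed (rule inv)

text \<open>On $L \otimes_K N$ the arrow of \<open>g\<close> is $g^{-1} \otimes 1$.\<close>

lemma induced_semilinear:
  assumes \<iota>: "field_extension \<iota>" and N: "N \<in> Ob C" and ind: "is_induced \<iota> C N (P, F)"
  obtains D where "\<And>g. g \<in> carrier (gal \<iota>) \<Longrightarrow> D g \<in> Hom C P P"
    and "\<And>g x. g \<in> carrier (gal \<iota>) \<Longrightarrow> Comp C (D g) (F (g x)) = Comp C (F x) (D g)"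
    and "\<And>g h. g \<in> carrier (gal \<iota>) \<Longrightarrow> h \<in> carrier (gal \<iota>) \<Longrightarrow> Comp C (D h) (D g) = D (g \<circ> h)"
    and "D id = Ident C P"
proof -
  interpret K: field_embedding \<iota> by unfold_locales (rule \<iota>)
  have PF: "(P, F) \<in> Ob (base_change \<iota> C)" using ind unfolding is_induced_def by blast
  note P = base_change_ObD(1)[OF PF] and F = base_change_ObD(2)[OF PF]
  from ind obtain S t prj where S: "finite_basis \<iota> S" and t: "\<And>x. t x \<in> Hom C N P"
    and t_add: "\<And>x y. t (x + y) = Add C (t x) (t y)" and t_scale: "\<And>k x. t (\<iota> k * x) = Scale C k (t x)"
    and ds: "direct_sum C S (\<lambda>_. N) P t prj" and Ft: "\<And>x y. Comp C (F x) (t y) = t (x * y)"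
    unfolding is_induced_def fst_conv snd_conv by blast
  have t_zero: "t 0 = Zero C N P"
    using add_eq_self_imp_zero[OF N P t, of 0] t_add[of 0 0] by simp
  have ext: "u = v" if "u \<in> Hom C P P" "v \<in> Hom C P P" "\<And>x. Comp C u (t x) = Comp C v (t x)" for u v
    by (rule direct_sum_eqI[OF ds]) (use that P N in auto)
  have "\<exists>D. D \<in> Hom C P P \<and> (\<forall>x. Comp C D (t x) = t (inv_into UNIV g x))" if g: "g \<in> carrier (gal \<iota>)" for g
  proof -
    let ?g = "inv_into UNIV g"
    have g': "?g \<in> carrier (gal \<iota>)" by (rule gal_inv[OF g])
    interpret g': field_embedding ?g by (rule gal_embedding[OF g'])
    obtain D where D: "D \<in> Hom C P P" "\<And>b. b \<in> S \<Longrightarrow> Comp C D (t b) = t (?g b)"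
      using direct_sum_copair[OF ds, of P "\<lambda>b. t (?g b)"] N P t by metis
    \<comment> \<open>Both sides are \<open>K\<close>-linear in \<open>x\<close> because
      \<open>?g\<close> fixes \<open>K\<close>, so agreement on the basis \<open>S\<close>, where
      \<open>D\<close> was prescribed, suffices.\<close>
    have "Comp C D (t x) = t (?g x)" for x
    proof (rule K.span_induct_alt[where S = S and h = "\<lambda>x. Comp C D (t x) = t (?g x)"])
      show "x \<in> K.span S" using S unfolding finite_basis_def by blast
      show "Comp C D (t 0) = t (?g 0)"
        using comp_zero_right[OF N P P D(1)] by (simp add: t_zero)
      fix k b y assume b: "b \<in> S" and y: "Comp C D (t y) = t (?g y)"
      have "Comp C D (t (\<iota> k * b + y)) = Add C (Comp C D (Scale C k (t b))) (t (?g y))"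
        unfolding t_add t_scale using comp_add_right[OF N P P _ t D(1), of "Scale C k (t b)" y] t_scale t y
        by metis
      also have "\<dots> = t (?g (\<iota> k * b + y))"
        using comp_scale_right[OF N P P t D(1), of k b] D(2)[OF b] galD(3)[OF g'] by (simp add: t_add t_scale)
      finally show "Comp C D (t (\<iota> k * b + y)) = t (?g (\<iota> k * b + y))" .
    qed
    then show ?thesis using D(1) by blast
  qed
  then obtain D where D: "\<And>g. g \<in> carrier (gal \<iota>) \<Longrightarrow> D g \<in> Hom C P P"
    and Dt: "\<And>g x. g \<in> carrier (gal \<iota>) \<Longrightarrow> Comp C (D g) (t x) = t (inv_into UNIV g x)"
    by metis
  show thesis
  proof (rule that[OF D])
    fix g x assume g: "g \<in> carrier (gal \<iota>)"
    interpret g': field_embedding "inv_into UNIV g" by (rule gal_embedding[OF gal_inv[OF g]])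
    show "Comp C (D g) (F (g x)) = Comp C (F x) (D g)"
    proof (rule ext)
      fix y
      have "Comp C (Comp C (D g) (F (g x))) (t y) = t (inv_into UNIV g (g x * y))"
        using comp_assoc[OF N P P P t F D[OF g]] by (simp add: Ft Dt[OF g])
      also have "\<dots> = t (x * inv_into UNIV g y)"
        using gal_inv_app(1)[OF g] by simp
      also have "\<dots> = Comp C (Comp C (F x) (D g)) (t y)"
        using comp_assoc[OF N P P P t D[OF g] F] by (simp add: Ft Dt[OF g])
      finally show "Comp C (Comp C (D g) (F (g x))) (t y) = Comp C (Comp C (F x) (D g)) (t y)" .
    qed (use comp_in_Hom[OF P P P] D[OF g] F in auto)
  next
    fix g h assume g: "g \<in> carrier (gal \<iota>)" and h: "h \<in> carrier (gal \<iota>)"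
    have gh: "g \<circ> h \<in> carrier (gal \<iota>)" by (rule gal_comp[OF g h])
    show "Comp C (D h) (D g) = D (g \<circ> h)"
    proof (rule ext)
      fix x
      have "inv_into UNIV h (inv_into UNIV g x) = inv_into UNIV (g \<circ> h) x"
        using gal_inv_app[OF g] gal_inv_app[OF h] gal_inv_app[OF gh] by (metis comp_apply)
      then show "Comp C (Comp C (D h) (D g)) (t x) = Comp C (D (g \<circ> h)) (t x)"
        unfolding comp_assoc[OF N P P P t D[OF g] D[OF h], symmetric] Dt[OF g] Dt[OF h] Dt[OF gh]
        by (rule arg_cong)
    qed (use comp_in_Hom[OF P P P] D g h gh in auto)
  next
    show "D id = Ident C P"
    proof (rule ext)
      show "Comp C (D id) (t x) = Comp C (Ident C P) (t x)" for x
        using Dt[OF gal_id] comp_ident_left[OF N P t] by simp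
    qed (use D[OF gal_id] ident_in_Hom[OF P] in auto)
  qed
qed

end

context galois_module
begin

text \<open>Conjugation by the isomorphism \<open>\<phi>\<close> with an induced object is
  multiplicative and carries the action \<open>F\<close> to \<open>f\<close>, since
  \<open>\<phi>\<close> is \<open>L\<close>-linear; so it carries the descent datum as well.\<close>

lemma descends_imp_datum:
  assumes "descends \<iota> C (N0, f)"
  shows "\<exists>c. descent_datum c"
proof -
  obtain N P F \<phi> \<psi> where N: "N \<in> Ob C" and ind: "is_induced \<iota> C N (P, F)"
    and inv: "inverse_pair (base_change \<iota> C) (N0, f) (P, F) \<phi> \<psi>"
    using assms unfolding descends_def isomorphic_def isos_def by force
  have PF: "(P, F) \<in> Ob (base_change \<iota> C)" using ind unfolding is_induced_def by blast
  note P = base_change_ObD(1)[OF PF] and F = base_change_ObD(2)[OF PF]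
  have \<phi>: "\<phi> \<in> Hom C N0 P" and \<psi>: "\<psi> \<in> Hom C P N0" and \<phi>f: "\<And>x. \<phi> \<star> f x = F x \<star> \<phi>"
    and \<psi>\<phi>: "\<psi> \<star> \<phi> = Ident C N0" and \<phi>\<psi>: "\<phi> \<star> \<psi> = Ident C P"
    using inv by (auto simp: inverse_pair_def)
  obtain D where D: "\<And>g. g \<in> G \<Longrightarrow> D g \<in> Hom C P P"
    and DF: "\<And>g x. g \<in> G \<Longrightarrow> D g \<star> F (g x) = F x \<star> D g"
    and DD: "\<And>g h. g \<in> G \<Longrightarrow> h \<in> G \<Longrightarrow> D h \<star> D g = D (g \<circ> h)"
    and D_id: "D id = Ident C P"
    using induced_semilinear[OF ext_\<iota> N ind] by blast
  define cj where "cj u = \<psi> \<star> u \<star> \<phi>" for u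
  have cj_comp: "cj u \<star> cj v = cj (u \<star> v)" if "u \<in> Hom C P P" "v \<in> Hom C P P" for u v
    unfolding cj_def by (rule conjugate_comp[OF N0 P \<phi> \<psi> \<phi>\<psi> that])
  have cj_in: "cj u \<in> E" if "u \<in> Hom C P P" for u
    unfolding cj_def by (rule comp_in_Hom[OF N0 P N0 comp_in_Hom[OF N0 P P \<phi> that] \<psi>])
  have cj_F: "cj (F x) = f x" for x
    unfolding cj_def \<phi>f[symmetric] using comp_assoc[OF N0 N0 P N0 f_in \<phi> \<psi>] \<psi>\<phi> by simp
  have cj_id: "cj (Ident C P) = Ident C N0"
    unfolding cj_def using comp_ident_left[OF N0 P \<phi>] \<psi>\<phi> by simp
  have "descent_datum (\<lambda>g. cj (D g))"
    unfolding descent_datum_def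
  proof (intro conjI ballI allI)
    fix g x assume g: "g \<in> G"
    show "cj (D g) \<star> f (g x) = f x \<star> cj (D g)"
      unfolding cj_F[symmetric] using cj_comp D[OF g] F DF[OF g] by metis
  qed (use D cj_in cj_comp DD D_id cj_id in auto)
  then show ?thesis by blast
qed

text \<open>As \<open>is_induced\<close> accepts every model of the tensor product, the object is
  itself a model, and the isomorphism is the identity.\<close>

lemma datum_imp_descends:
  assumes "descent_datum c"
  shows "descends \<iota> C (N0, f)"
proof -
  have "inverse_pair (base_change \<iota> C) (N0, f) (N0, f) (Ident C N0) (Ident C N0)"
    by (simp add: inverse_pair_def)
  then have "isomorphic (base_change \<iota> C) (N0, f) (N0, f)"
    unfolding isomorphic_def isos_def by blast
  then show ?thesis
    unfolding descends_def using descent_datum_induced[OF assms] by blast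
qed

text \<open>
  Replacing \<open>c g\<close> by \<open>c g \<star> f (inverse (b g))\<close> divides \<open>\<xi>\<close> by the coboundary of \<open>b\<close>.
\<close>

lemma xi_coboundary_iff_datum:
  assumes End: "bij_betw f UNIV (Hom (base_change \<iota> C) (N0, f) (N0, f))"
    and iso: "\<And>g. g \<in> G \<Longrightarrow> c g \<in> isos (base_change \<iota> C) (N0, f) (twist g (N0, f))"
  shows "(\<exists>b. (\<forall>g\<in>G. b g \<noteq> 0) \<and> (\<forall>g\<in>G. \<forall>h\<in>G.
      xi_cocycle \<iota> C (N0, f) c (g, h) = g (b h) * inverse (b (g \<circ> h)) * b g)) \<longleftrightarrow>
    (\<exists>c'. descent_datum c')"
proof -
  have "\<exists>k. inverse_pair (base_change \<iota> C) (N0, f) (N0, f \<circ> inv_into UNIV g) (c g) k" if "g \<in> G" for g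
    using iso[OF that] by (simp add: isos_def twist_def)
  then obtain k where k: "\<And>g. g \<in> G \<Longrightarrow>
      inverse_pair (base_change \<iota> C) (N0, f) (N0, f \<circ> inv_into UNIV g) (c g) (k g)"
    by metis
  have cE: "c g \<in> E" and kE: "k g \<in> E" and kc: "k g \<star> c g = Ident C N0" and ck: "c g \<star> k g = Ident C N0"
    and cf': "\<And>x. c g \<star> f x = f (inv_into UNIV g x) \<star> c g"
    and kf': "\<And>x. k g \<star> f (inv_into UNIV g x) = f x \<star> k g" if "g \<in> G" for g
    using k[OF that] by (auto simp: inverse_pair_def)
  have cf: "c g \<star> f (g x) = f x \<star> c g" if "g \<in> G" for g x
    using cf'[OF that, of "g x"] gal_inv_app(1)[OF that] by simp
  have kf: "k g \<star> f x = f (g x) \<star> k g" if "g \<in> G" for g x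
    using kf'[OF that, of "g x"] gal_inv_app(1)[OF that] by simp
  have kcc: "k g \<star> c g \<star> u = u" "c g \<star> k g \<star> u = u" if "g \<in> G" "u \<in> E" for g u
    using E_assoc[OF kE[OF that(1)] cE[OF that(1)] that(2)] E_assoc[OF cE[OF that(1)] kE[OF that(1)] that(2)]
      kc[OF that(1)] ck[OF that(1)] that(2) by simp_all
  have f_inj: "x = y" if "f x = f y" for x y
    using End that by (auto simp: bij_betw_def inj_eq)
  \<comment> \<open>Here hypothesis (2) enters: an endomorphism of \<open>N0\<close> that commutes
    with all scalars is an endomorphism in the base-changed category, hence a scalar.\<close>
  have central: "\<exists>x. f x = u" if "u \<in> E" "\<And>x. u \<star> f x = f x \<star> u" for u
  proof -
    have "u \<in> f ` UNIV" using End that by (simp add: bij_betw_def)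
    then show ?thesis by blast
  qed
  define \<xi> where "\<xi> = xi_cocycle \<iota> C (N0, f) c"
  have \<xi>: "c h \<star> c g = c (g \<circ> h) \<star> f (\<xi> (g, h))" if g: "g \<in> G" and h: "h \<in> G" for g h
  proof -
    have gh: "g \<circ> h \<in> G" by (rule gal_comp[OF g h])
    let ?u = "k (g \<circ> h) \<star> c h \<star> c g"
    have uE: "?u \<in> E" using cE kE g h gh by simp
    have "?u \<star> f y = f y \<star> ?u" for y
    proof -
      \<comment> \<open>Writing \<open>y\<close> as \<open>g (h x)\<close> lets the scalar pass
        \<open>c g\<close> as \<open>h x\<close>, then \<open>c h\<close> as \<open>x\<close>, and
        return to \<open>y\<close> on passing the inverse of \<open>c (g \<circ> h)\<close>.\<close>
      define x where "x = inv_into UNIV (g \<circ> h) y"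
      have y: "y = g (h x)" using gal_inv_app(2)[OF gh, of y] by (simp add: x_def)
      have "?u \<star> f y = k (g \<circ> h) \<star> c h \<star> c g \<star> f (g (h x))"
        using cE kE g h gh by (simp add: E_assoc y)
      also have "\<dots> = k (g \<circ> h) \<star> (c h \<star> f (h x)) \<star> c g"
        using cE g h by (simp add: cf[OF g] E_assoc)
      also have "\<dots> = (k (g \<circ> h) \<star> f x) \<star> c h \<star> c g"
        using cE kE g h gh by (simp add: cf[OF h] E_assoc)
      also have "\<dots> = f y \<star> ?u"
        using cE kE g h gh by (simp add: kf[OF gh] E_assoc y)
      finally show ?thesis .
    qed
    then obtain x where x: "f x = ?u" using central[OF uE] by metis
    have "inverse_arrow (base_change \<iota> C) (N0, f) (twist (g \<circ> h) (N0, f)) (c (g \<circ> h)) = k (g \<circ> h)"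
      unfolding twist_def prod.case by (rule inverse_arrow_eq[OF M N0 k[OF gh]])
    then have "\<xi> (g, h) = (THE x. f x = ?u)"
      using g h by (simp add: \<xi>_def xi_cocycle_def)
    also have "\<dots> = x" by (rule the_equality) (use x f_inj in auto)
    finally show ?thesis
      using x kcc(2)[OF gh, of "c h \<star> c g"] cE g h by simp
  qed
  have cancel: "x = y" if "g \<in> G" "c g \<star> f x = c g \<star> f y" for g x y
    using that kcc(1)[OF that(1) f_in] by (metis f_inj)
  show ?thesis
    unfolding \<xi>_def[symmetric]
  proof (intro iffI; elim exE conjE)
    fix b assume b: "\<forall>g\<in>G. b g \<noteq> 0"
      and \<xi>b: "\<forall>g\<in>G. \<forall>h\<in>G. \<xi> (g, h) = g (b h) * inverse (b (g \<circ> h)) * b g"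
    define c' where "c' g = c g \<star> f (inverse (b g))" for g
    have c'E: "c' g \<in> E" if "g \<in> G" for g
      unfolding c'_def using cE[OF that] by simp
    have comp: "c' h \<star> c' g = c' (g \<circ> h)" if g: "g \<in> G" and h: "h \<in> G" for g h
    proof -
      have gh: "g \<circ> h \<in> G" by (rule gal_comp[OF g h])
      interpret g: field_embedding g by (rule gal_embedding[OF g])
      have "c' h \<star> c' g = c h \<star> (f (inverse (b h)) \<star> c g) \<star> f (inverse (b g))"
        unfolding c'_def using cE g h by (simp add: E_assoc)
      also have "\<dots> = (c h \<star> c g) \<star> f (g (inverse (b h))) \<star> f (inverse (b g))"
        using cE g h by (simp add: cf[OF g, symmetric] E_assoc)
      also have "\<dots> = c (g \<circ> h) \<star> f (\<xi> (g, h) * (g (inverse (b h)) * inverse (b g)))"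
        using cE gh by (simp add: \<xi>[OF g h] E_assoc f_mult)
      also have "\<xi> (g, h) * (g (inverse (b h)) * inverse (b g)) = inverse (b (g \<circ> h))"
      proof -
        have "s * inverse u * v * (inverse s * inverse v) = inverse u" if "s \<noteq> 0" "v \<noteq> 0" for s u v :: 'l
          using that by (simp add: field_simps)
        from this[of "g (b h)" "b g" "b (g \<circ> h)"] show ?thesis
          using \<xi>b b g h by (metis g.hom_eq_0_iff g.hom_inverse)
      qed
      finally show ?thesis unfolding c'_def .
    qed
    \<comment> \<open>By \<open>comp\<close>, \<open>c' id\<close> is idempotent, and
      \<open>?v\<close> is a left inverse of it; such an idempotent is the identity.\<close>
    have "c' id = Ident C N0"
    proof -
      let ?v = "f (b id) \<star> k id"
      have id: "id \<in> G" by (rule gal_id)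
      have "?v \<star> c' id = f (b id) \<star> f (inverse (b id))"
        unfolding c'_def using cE[OF id] kE[OF id] by (simp add: E_assoc kcc[OF id])
      also have "\<dots> = Ident C N0" using b id by (simp add: f_mult[symmetric] f_one)
      finally have v: "?v \<star> c' id = Ident C N0" .
      have "?v \<star> c' id \<star> c' id = (?v \<star> c' id) \<star> c' id"
        using E_assoc[of ?v "c' id" "c' id"] kE[OF id] c'E[OF id] by simp
      then show ?thesis
        using comp[OF id id] v c'E[OF id] by simp
    qed
    moreover have "c' g \<star> f (g x) = f x \<star> c' g" if g: "g \<in> G" for g x
    proof -
      have "c' g \<star> f (g x) = c g \<star> f (inverse (b g) * g x)"
        unfolding c'_def using cE[OF g] by (simp add: E_assoc f_mult)
      also have "\<dots> = (c g \<star> f (g x)) \<star> f (inverse (b g))"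
        using cE[OF g] by (simp add: E_assoc f_mult[symmetric] mult.commute)
      also have "\<dots> = f x \<star> c' g"
        unfolding c'_def cf[OF g] using cE[OF g] by (simp add: E_assoc)
      finally show ?thesis .
    qed
    ultimately have "descent_datum c'"
      unfolding descent_datum_def using c'E comp by blast
    then show "\<exists>c'. descent_datum c'" by blast
  next
    fix c' assume "descent_datum c'"
    then have c'E: "\<And>g. g \<in> G \<Longrightarrow> c' g \<in> E" and c'f: "\<And>g x. g \<in> G \<Longrightarrow> c' g \<star> f (g x) = f x \<star> c' g"
      and comp: "\<And>g h. g \<in> G \<Longrightarrow> h \<in> G \<Longrightarrow> c' h \<star> c' g = c' (g \<circ> h)" and c'_id: "c' id = Ident C N0"
      unfolding descent_datum_def by blast+
    \<comment> \<open>\<open>c' g\<close> and \<open>c g\<close> are semilinear for the same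
      automorphism, so \<open>k g \<star> c' g\<close> is linear and \<open>central\<close> makes it
      a scalar.\<close>
    have "\<exists>x. c' g = c g \<star> f x" if g: "g \<in> G" for g
    proof -
      have "(k g \<star> c' g) \<star> f y = f y \<star> k g \<star> c' g" for y
      proof -
        define x where "x = inv_into UNIV g y"
        have y: "y = g x" using gal_inv_app(2)[OF g, of y] by (simp add: x_def)
        have "(k g \<star> c' g) \<star> f y = k g \<star> f x \<star> c' g"
          using kE[OF g] c'E[OF g] by (simp add: E_assoc y c'f[OF g])
        also have "\<dots> = (k g \<star> f x) \<star> c' g" using kE[OF g] c'E[OF g] by (simp add: E_assoc)
        also have "\<dots> = f y \<star> k g \<star> c' g" using kE[OF g] c'E[OF g] by (simp add: kf[OF g] E_assoc y)
        finally show ?thesis .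
      qed
      then obtain x where "f x = k g \<star> c' g"
        using central[of "k g \<star> c' g"] kE[OF g] c'E[OF g] by auto
      then show ?thesis using kcc(2)[OF g c'E[OF g]] by metis
    qed
    then obtain \<beta> where \<beta>: "\<And>g. g \<in> G \<Longrightarrow> c' g = c g \<star> f (\<beta> g)" by metis
    \<comment> \<open>A descent datum consists of invertible arrows, \<open>c' g\<close> having the
      left inverse at the inverse automorphism; a zero scalar would give 1 = 0 in
      \<open>L\<close>.\<close>
    have \<beta>0: "\<beta> g \<noteq> 0" if g: "g \<in> G" for g
    proof
      assume "\<beta> g = 0"
      then have "c' g = Zero C N0 N0" using \<beta>[OF g] cE[OF g] by (simp add: f_zero)
      moreover have "g \<circ> inv_into UNIV g = id" using gal_inv_app(2)[OF g] by auto
      ultimately have "f 1 = f 0"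
        using comp[OF g gal_inv[OF g]] c'E[OF gal_inv[OF g]] c'_id by (simp add: f_one f_zero)
      then show False using f_inj by fastforce
    qed
    have main: "\<xi> (g, h) * (g (\<beta> h) * \<beta> g) = \<beta> (g \<circ> h)" if g: "g \<in> G" and h: "h \<in> G" for g h
    proof (rule cancel)
      show gh: "g \<circ> h \<in> G" by (rule gal_comp[OF g h])
      have "c (g \<circ> h) \<star> f (\<xi> (g, h) * (g (\<beta> h) * \<beta> g)) = (c h \<star> c g) \<star> f (g (\<beta> h)) \<star> f (\<beta> g)"
        using cE gh by (simp add: \<xi>[OF g h] E_assoc f_mult)
      also have "\<dots> = c h \<star> (f (\<beta> h) \<star> c g) \<star> f (\<beta> g)"
        using cE g h by (simp add: cf[OF g, symmetric] E_assoc)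
      also have "\<dots> = c' h \<star> c' g"
        using cE g h by (simp add: \<beta>[OF g] \<beta>[OF h] E_assoc)
      also have "\<dots> = c (g \<circ> h) \<star> f (\<beta> (g \<circ> h))"
        using comp[OF g h] \<beta>[OF gh] by simp
      finally show "c (g \<circ> h) \<star> f (\<xi> (g, h) * (g (\<beta> h) * \<beta> g)) = c (g \<circ> h) \<star> f (\<beta> (g \<circ> h))" .
    qed
    \<comment> \<open>The cochain is the inverse of \<open>\<beta>\<close>, in accordance with the
      rescaling by \<open>inverse (b g)\<close> in the other direction.\<close>
    show "\<exists>b. (\<forall>g\<in>G. b g \<noteq> 0) \<and> (\<forall>g\<in>G. \<forall>h\<in>G. \<xi> (g, h) = g (b h) * inverse (b (g \<circ> h)) * b g)"
    proof (intro exI conjI ballI)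
      fix g h assume g: "g \<in> G" and h: "h \<in> G"
      interpret g: field_embedding g by (rule gal_embedding[OF g])
      show "\<xi> (g, h) = g (inverse (\<beta> h)) * inverse (inverse (\<beta> (g \<circ> h))) * inverse (\<beta> g)"
        using main[OF g h, symmetric] \<beta>0[OF g] \<beta>0[OF h] by (simp add: field_simps)
    qed (use \<beta>0 in auto)
  qed
qed

end

section \<open>Hilbert 90 and inflation\<close>

text \<open>
  Continuity makes the cocycle \<open>a\<close> factor through the finite set \<open>R\<close> of restrictions to a finite
  stable set \<open>F'\<close>, so the usual Poincare series is a finite sum.
\<close>

lemma hilbert_90:
  fixes \<kappa> :: "'k::field \<Rightarrow> 's::field"
  assumes gal: "galois_extension \<kappa>"
    and H: "H \<subseteq> carrier (gal \<kappa>)" "id \<in> H" "\<And>\<sigma> \<tau>. \<sigma> \<in> H \<Longrightarrow> \<tau> \<in> H \<Longrightarrow> \<sigma> \<circ> \<tau> \<in> H"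
      "\<And>\<sigma>. \<sigma> \<in> H \<Longrightarrow> inv_into UNIV \<sigma> \<in> H"
    and a: "\<And>\<sigma> \<tau>. \<sigma> \<in> H \<Longrightarrow> \<tau> \<in> H \<Longrightarrow> a (\<sigma> \<circ> \<tau>) = a \<sigma> * \<sigma> (a \<tau>)" "\<And>\<sigma>. \<sigma> \<in> H \<Longrightarrow> a \<sigma> \<noteq> 0"
    and F: "finite F" "\<And>\<sigma>. \<sigma> \<in> H \<Longrightarrow> (\<And>x. x \<in> F \<Longrightarrow> \<sigma> x = x) \<Longrightarrow> a \<sigma> = 1"
  obtains P where "P \<noteq> 0" "\<And>\<sigma>. \<sigma> \<in> H \<Longrightarrow> a \<sigma> * \<sigma> P = P"
proof -
  \<comment> \<open>The union of the \<open>H\<close>-orbits of the points of \<open>F\<close>: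
    still finite, and now stable, so that restrictions to it can be composed.\<close>
  define F' where "F' = (\<Union>x\<in>F. {\<sigma> x | \<sigma>. \<sigma> \<in> H})"
  have "finite {\<sigma> x | \<sigma>. \<sigma> \<in> H}" for x
    using orbit_finite[OF gal, of x] by (rule rev_finite_subset) (use H(1) in auto)
  then have finF': "finite F'" unfolding F'_def using F(1) by blast
  have stable: "\<sigma> x \<in> F'" if \<sigma>: "\<sigma> \<in> H" and x: "x \<in> F'" for \<sigma> x
  proof -
    obtain y \<tau> where "y \<in> F" "\<tau> \<in> H" "x = \<tau> y" using x unfolding F'_def by auto
    then have "\<sigma> x = (\<sigma> \<circ> \<tau>) y" "\<sigma> \<circ> \<tau> \<in> H" using H(3) \<sigma> by auto
    then show ?thesis unfolding F'_def using \<open>y \<in> F\<close> by blast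
  qed
  have "F \<subseteq> F'"
  proof
    fix x assume "x \<in> F"
    moreover have "x = id x" by simp
    ultimately show "x \<in> F'" unfolding F'_def using H(2) by blast
  qed
  have inv_app: "inv_into UNIV \<sigma> (\<sigma> x) = x" "\<sigma> (inv_into UNIV \<sigma> x) = x" if "\<sigma> \<in> H" for \<sigma> x
    using gal_inv_app[of \<sigma> \<kappa> x] that H(1) by auto
  have emb: "field_embedding \<sigma>" if "\<sigma> \<in> H" for \<sigma>
    using gal_embedding[of \<sigma> \<kappa>] that H(1) by auto
  \<comment> \<open>The elements on which an automorphism in \<open>H\<close> is determined by its
    restriction to \<open>F'\<close>. It is closed under products and contains
    \<open>F'\<close>.\<close>
  define E where "E = {\<theta>. \<forall>\<sigma>\<in>H. (\<forall>x\<in>F'. \<sigma> x = x) \<longrightarrow> \<sigma> \<theta> = \<theta>}"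
  \<comment> \<open>Two such automorphisms differ on the right by some \<open>\<tau>\<close> that
    fixes \<open>F'\<close>, hence \<open>F\<close>; so \<open>a \<tau> = 1\<close> and the cocycle
    relation gives equal values.\<close>
  have agree: "a \<sigma> = a \<sigma>' \<and> (\<forall>\<theta>\<in>E. \<sigma> \<theta> = \<sigma>' \<theta>)"
    if \<sigma>: "\<sigma> \<in> H" "\<sigma>' \<in> H" and eq: "\<And>x. x \<in> F' \<Longrightarrow> \<sigma> x = \<sigma>' x" for \<sigma> \<sigma>'
  proof -
    define \<tau> where "\<tau> = inv_into UNIV \<sigma>' \<circ> \<sigma>"
    have \<tau>: "\<tau> \<in> H" "\<sigma>' \<circ> \<tau> = \<sigma>"
      unfolding \<tau>_def using H(3,4) \<sigma> by (auto simp: inv_app)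
    have fx: "\<tau> x = x" if "x \<in> F'" for x
      using that eq \<sigma> by (simp add: \<tau>_def inv_app)
    have "a \<tau> = 1" by (rule F(2)) (use \<tau> fx \<open>F \<subseteq> F'\<close> in auto)
    then have 1: "a \<sigma> = a \<sigma>'"
      using a(1)[OF \<sigma>(2) \<tau>(1)] \<tau>(2) field_embedding.hom_one[OF emb[OF \<sigma>(2)]] by simp
    have "\<sigma> \<theta> = \<sigma>' \<theta>" if "\<theta> \<in> E" for \<theta>
    proof -
      have "\<tau> \<theta> = \<theta>" using that \<tau> fx unfolding E_def by blast
      then show ?thesis using \<tau>(2) by (metis comp_apply)
    qed
    with 1 show ?thesis by blast
  qed
  define R where "R = (\<lambda>\<sigma>. restrict \<sigma> F') ` H"
  have "R \<subseteq> (\<Pi>\<^sub>E x\<in>F'. F')" unfolding R_def using stable by auto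
  then have finR: "finite R"
    using finF' by (meson finite_PiE finite_subset)
  have "\<forall>\<rho>\<in>R. \<exists>\<sigma>\<in>H. restrict \<sigma> F' = \<rho>" unfolding R_def by auto
  then obtain rep where rep: "\<And>\<rho>. \<rho> \<in> R \<Longrightarrow> rep \<rho> \<in> H" "\<And>\<rho>. \<rho> \<in> R \<Longrightarrow> restrict (rep \<rho>) F' = \<rho>"
    by metis
  have rep_app: "rep \<rho> x = \<rho> x" if "\<rho> \<in> R" "x \<in> F'" for \<rho> x
    using rep(2)[OF that(1)] that(2) by (metis restrict_apply')
  \<comment> \<open>One representative per restriction; for \<open>\<theta>\<close> in
    \<open>E\<close> the terms are independent of the choice by \<open>agree\<close>.\<close>
  define P where "P \<theta> = (\<Sum>\<rho>\<in>R. a (rep \<rho>) * rep \<rho> \<theta>)" for \<theta>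
  have "restrict id F' \<in> R" unfolding R_def using H(2) by blast
  have "\<exists>\<theta>\<in>E. P \<theta> \<noteq> 0"
  proof (rule ccontr)
    assume "\<not> ?thesis"
    then have 0: "(\<Sum>\<rho>\<in>R. a (rep \<rho>) * rep \<rho> \<theta>) = 0" if "\<theta> \<in> E" for \<theta>
      using that unfolding P_def by blast
    have "F' \<subseteq> E" unfolding E_def by auto
    \<comment> \<open>Representatives of different restrictions differ on \<open>F'\<close>, hence
      are distinct characters of the monoid \<open>E\<close>; independence is therefore used on
      \<open>E\<close> and not on the whole field.\<close>
    have "a (rep (restrict id F')) = 0"
    proof (rule dedekind_independence[where I = R and E = E and \<chi> = rep and a = "\<lambda>\<rho>. a (rep \<rho>)"])
      show "\<exists>x\<in>E. rep \<rho> x \<noteq> rep \<rho>' x" if "\<rho> \<in> R" "\<rho>' \<in> R" "\<rho> \<noteq> \<rho>'" for \<rho> \<rho>'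
      proof (rule ccontr)
        assume "\<not> ?thesis"
        then have "restrict (rep \<rho>) F' = restrict (rep \<rho>') F'" using \<open>F' \<subseteq> E\<close> by (auto simp: restrict_def fun_eq_iff)
        then show False using rep(2) that by simp
      qed
    qed (use finR rep(1) emb 0 \<open>restrict id F' \<in> R\<close> in
        \<open>auto simp: E_def field_embedding.hom_mult field_embedding.hom_one\<close>)
    then show False using a(2) rep(1) \<open>restrict id F' \<in> R\<close> by blast
  qed
  then obtain \<theta> where \<theta>: "\<theta> \<in> E" "P \<theta> \<noteq> 0" by blast
  have "a \<sigma> * \<sigma> (P \<theta>) = P \<theta>" if \<sigma>: "\<sigma> \<in> H" for \<sigma>
  proof -
    \<comment> \<open>Left composition with \<open>\<sigma>\<close>, seen on restrictions; it
      permutes them, which is the usual shift of the summation index.\<close>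
    define \<pi> where "\<pi> \<rho> = restrict (\<sigma> \<circ> \<rho>) F'" for \<rho>
    have \<pi>_rep: "\<pi> \<rho> = restrict (\<sigma> \<circ> rep \<rho>) F'" if "\<rho> \<in> R" for \<rho>
      unfolding \<pi>_def using rep_app[OF that] by (auto simp: restrict_def)
    have "\<pi> ` R \<subseteq> R"
      using \<pi>_rep H(3)[OF \<sigma> rep(1)] unfolding R_def by auto
    moreover have "inj_on \<pi> R"
    proof (rule inj_onI)
      fix \<rho> \<rho>' assume *: "\<rho> \<in> R" "\<rho>' \<in> R" "\<pi> \<rho> = \<pi> \<rho>'"
      have "\<rho> x = \<rho>' x" for x
      proof (cases "x \<in> F'")
        case True
        then have "\<sigma> (\<rho> x) = \<sigma> (\<rho>' x)"
          using fun_cong[OF *(3), of x] by (simp add: \<pi>_def)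
        then show ?thesis using inv_app(1)[OF \<sigma>] by metis
      next
        case False
        then show ?thesis using *(1,2) unfolding R_def by auto
      qed
      then show "\<rho> = \<rho>'" by blast
    qed
    ultimately have bij: "bij_betw \<pi> R R"
      using endo_inj_surj[OF finR] by (simp add: bij_betw_def)
    interpret \<sigma>: field_embedding \<sigma> by (rule emb[OF \<sigma>])
    have "a \<sigma> * \<sigma> (P \<theta>) = (\<Sum>\<rho>\<in>R. a (\<sigma> \<circ> rep \<rho>) * (\<sigma> \<circ> rep \<rho>) \<theta>)"
      unfolding P_def \<sigma>.hom_sum sum_distrib_left
      by (rule sum.cong) (simp_all add: a(1)[OF \<sigma> rep(1)] mult.assoc)
    also have "\<dots> = (\<Sum>\<rho>\<in>R. a (rep (\<pi> \<rho>)) * rep (\<pi> \<rho>) \<theta>)"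
    proof (rule sum.cong)
      fix \<rho> assume \<rho>: "\<rho> \<in> R"
      have "\<pi> \<rho> \<in> R" using \<rho> bij by (auto simp: bij_betw_def)
      then have "a (\<sigma> \<circ> rep \<rho>) = a (rep (\<pi> \<rho>)) \<and> (\<forall>\<theta>\<in>E. (\<sigma> \<circ> rep \<rho>) \<theta> = rep (\<pi> \<rho>) \<theta>)"
        using rep_app rep(1) H(3)[OF \<sigma>] \<rho> by (intro agree) (auto simp: \<pi>_rep)
      then show "a (\<sigma> \<circ> rep \<rho>) * (\<sigma> \<circ> rep \<rho>) \<theta> = a (rep (\<pi> \<rho>)) * rep (\<pi> \<rho>) \<theta>"
        using \<theta>(1) by simp
    qed simp
    also have "\<dots> = P \<theta>"
      unfolding P_def by (rule sum.reindex_bij_betw[OF bij])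
    finally show ?thesis .
  qed
  then show thesis using that \<theta>(2) by blast
qed

section \<open>Restriction of automorphisms in the tower from \<open>K\<close> through
  \<open>L\<close> to \<open>S\<close>\<close>

locale galois_tower =
  fixes \<iota> :: "'k::field \<Rightarrow> 'l::field" and j :: "'l \<Rightarrow> 's::field" and B :: "'l set"
  assumes gal_\<iota>: "galois_extension \<iota>" and basis: "finite_basis \<iota> B"
    and ext_j: "field_extension j" and gal_S: "galois_extension (j \<circ> \<iota>)"
begin

abbreviation G where "G \<equiv> carrier (gal \<iota>)"
abbreviation \<Gamma> where "\<Gamma> \<equiv> carrier (gal (j \<circ> \<iota>))"
abbreviation res where "res \<equiv> restrict_aut j"

sublocale j: field_embedding j by unfold_locales (rule ext_j)

lemma ext_\<iota>: "field_extension \<iota>"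
  using gal_\<iota> unfolding galois_extension_def by blast

sublocale \<iota>: field_embedding \<iota> by unfold_locales (rule ext_\<iota>)

lemma fixed_L: "(\<And>g. g \<in> G \<Longrightarrow> g x = x) \<Longrightarrow> x \<in> range \<iota>"
  using gal_\<iota> unfolding galois_extension_def by blast

lemma fixed_S: "(\<And>\<sigma>. \<sigma> \<in> \<Gamma> \<Longrightarrow> \<sigma> x = x) \<Longrightarrow> x \<in> range (j \<circ> \<iota>)"
  using gal_S unfolding galois_extension_def by blast

text \<open>Normality of \<open>L\<close>: the polynomial \<open>q\<close> whose roots are the
  conjugates of \<open>x\<close> has coefficients fixed by \<open>G\<close>, hence in
  \<open>K\<close>. So \<open>\<sigma>\<close> sends \<open>j x\<close> to a root of the image of
  \<open>q\<close>, and these roots all lie in the image of \<open>j\<close>.\<close>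

lemma image_stable:
  assumes \<sigma>: "\<sigma> \<in> \<Gamma>"
  shows "\<sigma> (j x) \<in> range j"
proof -
  define Y where "Y = (\<lambda>g. g x) ` G"
  have finY: "finite Y"
    unfolding Y_def using orbit_finite[OF gal_\<iota>, of x] by (simp add: Setcompr_eq_image)
  define q where "q = (\<Prod>y\<in>Y. [:- y, 1:])"
  have "coeff q n \<in> range \<iota>" for n
  proof (rule fixed_L)
    fix g assume g: "g \<in> G"
    interpret g: field_embedding g by (rule gal_embedding[OF g])
    have "g ` Y \<subseteq> Y"
    proof (clarsimp simp: Y_def)
      fix h assume "h \<in> G"
      then show "g (h x) \<in> (\<lambda>g. g x) ` G"
        using gal_comp[OF g] by (intro image_eqI[of _ _ "g \<circ> h"]) auto
    qed
    then have bij: "bij_betw g Y Y"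
      using endo_inj_surj[OF finY, of g] inj_on_subset[OF g.inj, of Y] by (simp add: bij_betw_def)
    have "map_poly g q = (\<Prod>y\<in>Y. [:- g y, 1:])"
      by (simp add: q_def g.map_poly_prod map_poly_pCons)
    also have "\<dots> = q"
      unfolding q_def using prod.reindex_bij_betw[OF bij, of "\<lambda>y. [:- y, 1:]"] by simp
    finally show "g (coeff q n) = coeff q n" by (metis coeff_map_poly g.hom_zero)
  qed
  then have "\<exists>k. coeff q n = \<iota> k" for n by blast
  then have coeff: "\<sigma> (j (coeff q n)) = j (coeff q n)" for n
    using galD(3)[OF \<sigma>] by (metis comp_apply)
  interpret \<sigma>: field_embedding \<sigma> by (rule gal_embedding[OF \<sigma>])
  have "map_poly \<sigma> (map_poly j q) = map_poly j q"
    by (rule poly_eqI) (simp add: coeff_map_poly coeff)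
  then have root: "poly (map_poly j q) (\<sigma> (j x)) = \<sigma> (j (poly q x))"
    by (metis \<sigma>.poly_map_poly j.poly_map_poly)
  have "x \<in> Y" unfolding Y_def using gal_id[of \<iota>] by (intro image_eqI[of _ _ id]) auto
  then have "poly q x = 0" unfolding q_def using finY by (auto simp: poly_prod)
  with root have "(\<Prod>y\<in>Y. \<sigma> (j x) - j y) = 0"
    by (simp add: q_def j.map_poly_prod map_poly_pCons poly_prod)
  then show ?thesis using finY by auto
qed

lemma j_res: "\<sigma> \<in> \<Gamma> \<Longrightarrow> j (res \<sigma> x) = \<sigma> (j x)"
  using image_stable by (simp add: restrict_aut_def f_inv_into_f)

lemma res_comp: "\<sigma> \<in> \<Gamma> \<Longrightarrow> \<tau> \<in> \<Gamma> \<Longrightarrow> res (\<sigma> \<circ> \<tau>) = res \<sigma> \<circ> res \<tau>"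
  using gal_comp[of \<sigma> "j \<circ> \<iota>" \<tau>] j.inj by (auto simp: fun_eq_iff j_res inj_eq[symmetric])

lemma res_id [simp]: "res id = id"
  using j.inj by (simp add: restrict_aut_def fun_eq_iff)

lemma res_in:
  assumes \<sigma>: "\<sigma> \<in> \<Gamma>"
  shows "res \<sigma> \<in> G"
proof -
  interpret \<sigma>: field_embedding \<sigma> by (rule gal_embedding[OF \<sigma>])
  have inj: "u = v" if "j u = j v" for u v using that j.inj by (simp add: inj_eq)
  have "field_extension (res \<sigma>)"
    unfolding field_extension_iff by (auto intro!: inj simp: j_res \<sigma>)
  moreover have "bij (res \<sigma>)"
  proof (rule o_bij)
    have "inv_into UNIV \<sigma> \<in> \<Gamma>" by (rule gal_inv[OF \<sigma>])
    moreover have "\<sigma> \<circ> inv_into UNIV \<sigma> = id" "inv_into UNIV \<sigma> \<circ> \<sigma> = id"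
      by (auto simp: gal_inv_app[OF \<sigma>])
    ultimately show "res (inv_into UNIV \<sigma>) \<circ> res \<sigma> = id" "res \<sigma> \<circ> res (inv_into UNIV \<sigma>) = id"
      using \<sigma> by (metis res_comp res_id)+
  qed
  moreover have "res \<sigma> (\<iota> k) = \<iota> k" for k
    using galD(3)[OF \<sigma>, of k] by (intro inj) (simp add: j_res \<sigma>)
  ultimately show ?thesis by (simp add: carrier_gal_iff)
qed

lemma finite_G: "finite G"
  by (rule gal_finite[OF gal_\<iota> basis])

text \<open>
  An automorphism \<open>h\<close> outside the image of \<open>res\<close> would be a linear combination of those in the
  image, because the image already has fixed field \<open>K\<close>.
\<close>

lemma res_surj: "res ` \<Gamma> = G"
proof
  show sub: "res ` \<Gamma> \<subseteq> G" using res_in by blast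
  let ?G = "res ` \<Gamma>"
  have fin: "finite ?G" using sub finite_G finite_subset by blast
  have id: "id \<in> ?G" using gal_id[of "j \<circ> \<iota>"] res_id by (metis imageI)
  have comp: "g \<circ> h \<in> ?G" if gh: "g \<in> ?G" "h \<in> ?G" for g h
  proof -
    obtain \<sigma> \<tau> where "\<sigma> \<in> \<Gamma>" "\<tau> \<in> \<Gamma>" "g = res \<sigma>" "h = res \<tau>"
      using gh by blast
    then show ?thesis using gal_comp[of \<sigma> _ \<tau>] by (metis imageI res_comp)
  qed
  have fixed: "x \<in> range \<iota>" if fx: "\<And>g. g \<in> ?G \<Longrightarrow> g x = x" for x
  proof -
    have "\<sigma> (j x) = j x" if "\<sigma> \<in> \<Gamma>" for \<sigma>
      using j_res[OF that, of x] fx[OF imageI[OF that]] by simp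
    then obtain k where "j x = j (\<iota> k)" using fixed_S[of "j x"] by auto
    then show ?thesis using j.inj by (auto simp: inj_eq)
  qed
  obtain d where d: "\<And>x. (\<Sum>b\<in>B. b * (\<Sum>g\<in>?G. g (d b * x))) = x"
    using dual_basis[OF ext_\<iota> basis fin sub comp id fixed] by auto
  show "G \<subseteq> ?G"
  proof (rule subsetI, rule ccontr)
    fix h assume h: "h \<in> G" "h \<notin> ?G"
    interpret h: field_embedding h by (rule gal_embedding[OF h(1)])
    have emb: "field_embedding g" if "g \<in> ?G" for g using gal_embedding that sub by blast
    \<comment> \<open>Sums over the image are fixed by the image, hence lie in \<open>K\<close>,
      where even the hypothetical \<open>h\<close> acts trivially.\<close>
    have Tr: "h (\<Sum>g\<in>?G. g x) = (\<Sum>g\<in>?G. g x)" for x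
    proof -
      have "(\<Sum>g\<in>?G. g x) \<in> range \<iota>"
      proof (rule fixed)
        fix g assume g: "g \<in> ?G"
        have "g (\<Sum>g\<in>?G. g x) = (\<Sum>g'\<in>?G. (g \<circ> g') x)"
          by (simp add: field_embedding.hom_sum[OF emb[OF g]])
        also have "\<dots> = (\<Sum>g'\<in>?G. g' x)"
          by (rule sum.reindex_bij_betw[OF gal_comp_image[OF sub comp fin g], of "\<lambda>g. g x"])
        finally show "g (\<Sum>g\<in>?G. g x) = (\<Sum>g\<in>?G. g x)" .
      qed
      then show ?thesis using galD(3)[OF h(1)] by auto
    qed
    \<comment> \<open>Applying \<open>h\<close> to the expansion of \<open>x\<close> in the dual
      basis affects only the factors \<open>b\<close>, since the traces are in \<open>K\<close>.
      This expresses \<open>h\<close> through the image with the coefficients given here; the value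
      \<open>- 1\<close> at \<open>h\<close> makes it a relation.\<close>
    define u where "u g = (if g = h then - 1 else (\<Sum>b\<in>B. h b * g (d b)))" for g
    have "u h = 0"
    proof (rule dedekind_automorphisms[where G = "insert h ?G" and \<iota> = \<iota> and a = u and g = h])
      fix x
      have "(\<Sum>g\<in>?G. u g * g x) = (\<Sum>g\<in>?G. (\<Sum>b\<in>B. h b * g (d b)) * g x)"
        by (rule sum.cong) (use h(2) in \<open>auto simp: u_def\<close>)
      also have "\<dots> = (\<Sum>b\<in>B. h b * (\<Sum>g\<in>?G. g (d b * x)))"
        unfolding sum_distrib_right sum_distrib_left
        by (subst sum.swap) (auto intro!: sum.cong simp: field_embedding.hom_mult[OF emb] mult.assoc)
      also have "\<dots> = h (\<Sum>b\<in>B. b * (\<Sum>g\<in>?G. g (d b * x)))"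
        by (simp only: h.hom_sum[of _ B] h.hom_mult Tr)
      also have "\<dots> = h x" using d[of x] by simp
      finally show "(\<Sum>g\<in>insert h ?G. u g * g x) = 0"
        using fin h(2) by (simp add: u_def)
    qed (use sub h fin in auto)
    then show False by (simp add: u_def)
  qed
qed

text \<open>For such an \<open>s\<close> the value \<open>\<sigma> s\<close> depends only on
  \<open>res \<sigma>\<close>, so \<open>G\<close> acts on \<open>s\<close> through arbitrary lifts.
  The traces \<open>T b\<close> of \<open>j (d b) * s\<close> are then fixed by all of
  \<open>\<Gamma>\<close>, hence in \<open>K\<close>, and \<open>s\<close> is the sum of the
  \<open>j b * T b\<close>.\<close>

lemma fixed_by_kernel:
  assumes s: "\<And>\<sigma>. \<sigma> \<in> \<Gamma> \<Longrightarrow> res \<sigma> = id \<Longrightarrow> \<sigma> s = s"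
  shows "s \<in> range j"
proof -
  obtain d where d: "\<And>g. g \<in> G \<Longrightarrow> (\<Sum>b\<in>B. b * g (d b)) = (if g = id then 1 else 0)"
    using gal_dual_basis[OF gal_\<iota> basis] by metis
  have "\<forall>g\<in>G. \<exists>\<sigma>\<in>\<Gamma>. res \<sigma> = g" using res_surj by (metis imageE)
  then obtain lft where lft: "\<And>g. g \<in> G \<Longrightarrow> lft g \<in> \<Gamma>" "\<And>g. g \<in> G \<Longrightarrow> res (lft g) = g"
    by metis
  have same: "\<sigma> s = \<tau> s" if "\<sigma> \<in> \<Gamma>" "\<tau> \<in> \<Gamma>" "res \<sigma> = res \<tau>" for \<sigma> \<tau>
  proof -
    let ?\<rho> = "inv_into UNIV \<tau> \<circ> \<sigma>"
    have "inv_into UNIV \<tau> \<in> \<Gamma>" by (rule gal_inv[OF that(2)])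
    moreover have "inv_into UNIV \<tau> \<circ> \<tau> = id" using gal_inv_app[OF that(2)] by auto
    ultimately have "res ?\<rho> = id" using that by (metis res_comp res_id)
    moreover have "?\<rho> \<in> \<Gamma>" by (rule gal_comp[OF gal_inv[OF that(2)] that(1)])
    ultimately have "?\<rho> s = s" using s by blast
    then show ?thesis using gal_inv_app[OF that(2)] by (metis comp_apply)
  qed
  define T where "T b = (\<Sum>g\<in>G. lft g (j (d b) * s))" for b
  have "T b \<in> range (j \<circ> \<iota>)" for b
  proof (rule fixed_S)
    fix \<sigma> assume \<sigma>: "\<sigma> \<in> \<Gamma>"
    interpret \<sigma>: field_embedding \<sigma> by (rule gal_embedding[OF \<sigma>])
    have "\<sigma> (T b) = (\<Sum>g\<in>G. lft (res \<sigma> \<circ> g) (j (d b) * s))"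
      unfolding T_def \<sigma>.hom_sum
    proof (rule sum.cong)
      fix g assume g: "g \<in> G"
      have *: "res \<sigma> \<circ> g \<in> G" "\<sigma> \<circ> lft g \<in> \<Gamma>"
        using gal_comp res_in \<sigma> g lft(1) by blast+
      interpret l: field_embedding "lft g" by (rule gal_embedding[OF lft(1)[OF g]])
      interpret l': field_embedding "lft (res \<sigma> \<circ> g)" by (rule gal_embedding[OF lft(1)[OF *(1)]])
      have "res (\<sigma> \<circ> lft g) = res (lft (res \<sigma> \<circ> g))"
        using res_comp[OF \<sigma> lft(1)[OF g]] lft(2)[OF g] lft(2)[OF *(1)] by simp
      then have "(\<sigma> \<circ> lft g) s = lft (res \<sigma> \<circ> g) s" "(\<sigma> \<circ> lft g) (j (d b)) = lft (res \<sigma> \<circ> g) (j (d b))"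
        using same[OF *(2) lft(1)[OF *(1)]] j_res[OF *(2)] j_res[OF lft(1)[OF *(1)]] by metis+
      then show "\<sigma> (lft g (j (d b) * s)) = lft (res \<sigma> \<circ> g) (j (d b) * s)" by simp
    qed simp
    also have "\<dots> = T b"
      unfolding T_def
      by (rule sum.reindex_bij_betw[OF gal_comp_bij[OF res_in[OF \<sigma>]], of "\<lambda>g. lft g (j (d b) * s)"])
    finally show "\<sigma> (T b) = T b" .
  qed
  then have T: "T b \<in> range j" for b by fastforce
  have "(\<Sum>b\<in>B. j b * T b) = (\<Sum>g\<in>G. j (\<Sum>b\<in>B. b * g (d b)) * lft g s)"
    unfolding T_def sum_distrib_left j.hom_sum sum_distrib_right
    by (subst sum.swap)
       (auto intro!: sum.cong simp: field_embedding.hom_mult[OF gal_embedding[OF lft(1)]]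
          j_res[OF lft(1), symmetric] lft(2))
  also have "\<dots> = (\<Sum>g\<in>G. if g = id then s else 0)"
  proof (rule sum.cong)
    fix g assume g: "g \<in> G"
    have "lft id s = id s"
      using same[OF lft(1)[OF gal_id] gal_id] lft(2)[OF gal_id] by simp
    then show "j (\<Sum>b\<in>B. b * g (d b)) * lft g s = (if g = id then s else 0)"
      using d[OF g] by simp
  qed simp
  also have "\<dots> = s" using finite_G gal_id[of \<iota>] by simp
  finally have s_eq: "s = (\<Sum>b\<in>B. j b * T b)" ..
  from T have "\<forall>b. \<exists>y. T b = j y" by blast
  then obtain y where "\<And>b. T b = j (y b)" by metis
  then have "s = j (\<Sum>b\<in>B. b * y b)" using s_eq by (simp add: j.hom_sum)
  then show ?thesis by blast
qed

text \<open>When one argument lies in the kernel \<open>H\<close> of restriction, the inflated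
  function does not see it. Hence \<open>b / b id\<close> is a 1-cocycle on \<open>H\<close>, and
  Hilbert 90 writes it as \<open>P / \<sigma> P\<close>. Multiplying \<open>b\<close> by
  \<open>\<sigma> P / P\<close>, whose coboundary is trivial, gives a function \<open>c\<close>
  constant on cosets of \<open>H\<close> with values fixed by \<open>H\<close>, that is, a cochain
  on \<open>G\<close> with values in \<open>L\<close>.\<close>

lemma inflation_injective:
  assumes b: "\<And>\<sigma>. \<sigma> \<in> \<Gamma> \<Longrightarrow> b \<sigma> \<noteq> 0"
    and F: "finite F" "\<And>\<sigma>. \<sigma> \<in> \<Gamma> \<Longrightarrow> (\<And>x. x \<in> F \<Longrightarrow> \<sigma> x = x) \<Longrightarrow> b \<sigma> = b id"
    and z: "\<And>\<sigma> \<tau>. \<sigma> \<in> \<Gamma> \<Longrightarrow> \<tau> \<in> \<Gamma> \<Longrightarrow>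
      j (z (res \<sigma>, res \<tau>)) = \<sigma> (b \<tau>) * inverse (b (\<sigma> \<circ> \<tau>)) * b \<sigma>"
  obtains b0 where "\<And>g. g \<in> G \<Longrightarrow> b0 g \<noteq> 0"
    and "\<And>g h. g \<in> G \<Longrightarrow> h \<in> G \<Longrightarrow> z (g, h) = g (b0 h) * inverse (b0 (g \<circ> h)) * b0 g"
proof -
  define H where "H = {\<sigma> \<in> \<Gamma>. res \<sigma> = id}"
  have H: "H \<subseteq> \<Gamma>" "id \<in> H" "\<And>\<sigma> \<tau>. \<sigma> \<in> H \<Longrightarrow> \<tau> \<in> H \<Longrightarrow> \<sigma> \<circ> \<tau> \<in> H"
    unfolding H_def using gal_id gal_comp by (auto simp: res_comp)
  have inv_comp: "inv_into UNIV \<sigma> \<circ> \<sigma> = id" "\<sigma> \<circ> inv_into UNIV \<sigma> = id" if "\<sigma> \<in> \<Gamma>" for \<sigma>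
    using gal_inv_app[OF that] by auto
  have H_inv: "inv_into UNIV \<sigma> \<in> H" if "\<sigma> \<in> H" for \<sigma>
  proof -
    have "inv_into UNIV \<sigma> \<in> \<Gamma>" using gal_inv that unfolding H_def by blast
    moreover from this have "res (inv_into UNIV \<sigma>) \<circ> res \<sigma> = id"
      using that inv_comp unfolding H_def by (metis (mono_tags, lifting) mem_Collect_eq res_comp res_id)
    ultimately show ?thesis using that unfolding H_def by simp
  qed
  have emb: "field_embedding \<sigma>" if "\<sigma> \<in> \<Gamma>" for \<sigma> by (rule gal_embedding[OF that])
  note hom = field_embedding.hom_mult[OF emb] field_embedding.hom_divide[OF emb]
    field_embedding.hom_inverse[OF emb] field_embedding.hom_eq_0_iff[OF emb]
  have id: "id \<in> \<Gamma>" by (rule gal_id)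
  \<comment> \<open>The values of \<open>z\<close> belonging to the pairs
    \<open>(\<sigma>, \<tau>)\<close> and \<open>(\<sigma>, id)\<close> are the same; equating the
    two coboundary expressions gives the formula.\<close>
  have right: "b (\<sigma> \<circ> \<tau>) = b \<sigma> * \<sigma> (b \<tau> / b id)" if \<sigma>: "\<sigma> \<in> \<Gamma>" and \<tau>: "\<tau> \<in> H" for \<sigma> \<tau>
  proof -
    have \<tau>': "\<tau> \<in> \<Gamma>" "res \<tau> = id" using \<tau> unfolding H_def by auto
    have "\<sigma> (b \<tau>) * inverse (b (\<sigma> \<circ> \<tau>)) * b \<sigma> = \<sigma> (b id) * inverse (b \<sigma>) * b \<sigma>"
      using z[OF \<sigma> \<tau>'(1)] z[OF \<sigma> id] \<tau>'(2) by simp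
    then show ?thesis
      using b[OF \<sigma>] b[OF \<tau>'(1)] b[OF id] b[OF gal_comp[OF \<sigma> \<tau>'(1)]] \<sigma>
      by (simp add: hom field_simps)
  qed
  have left: "b (\<tau> \<circ> \<sigma>) = \<tau> (b \<sigma>) * (b \<tau> / b id)" if \<sigma>: "\<sigma> \<in> \<Gamma>" and \<tau>: "\<tau> \<in> H" for \<sigma> \<tau>
  proof -
    have \<tau>': "\<tau> \<in> \<Gamma>" "res \<tau> = id" using \<tau> unfolding H_def by auto
    have "\<tau> (b \<sigma>) * inverse (b (\<tau> \<circ> \<sigma>)) * b \<tau> = b \<sigma> * inverse (b \<sigma>) * b id"
      using z[OF \<tau>'(1) \<sigma>] z[OF id \<sigma>] \<tau>'(2) by simp
    then show ?thesis
      using b[OF \<sigma>] b[OF \<tau>'(1)] b[OF id] b[OF gal_comp[OF \<tau>'(1) \<sigma>]] \<sigma>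
      by (simp add: field_simps)
  qed
  define a where "a \<sigma> = b \<sigma> / b id" for \<sigma>
  obtain P where P: "P \<noteq> 0" "\<And>\<sigma>. \<sigma> \<in> H \<Longrightarrow> a \<sigma> * \<sigma> P = P"
  proof (rule hilbert_90[OF gal_S H H_inv, where a = a and F = F])
    show "a (\<sigma> \<circ> \<tau>) = a \<sigma> * \<sigma> (a \<tau>)" if "\<sigma> \<in> H" "\<tau> \<in> H" for \<sigma> \<tau>
      using right[of \<sigma> \<tau>] that H(1) unfolding a_def by auto
    show "a \<sigma> \<noteq> 0" if "\<sigma> \<in> H" for \<sigma>
      using b that H(1) id unfolding a_def by auto
    show "a \<sigma> = 1" if "\<sigma> \<in> H" "\<And>x. x \<in> F \<Longrightarrow> \<sigma> x = x" for \<sigma>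
      using F(2)[of \<sigma>] that H(1) b[OF id] unfolding a_def by auto
  qed (use F(1) in auto)
  define c where "c \<sigma> = b \<sigma> * \<sigma> P / P" for \<sigma>
  have c0: "c \<sigma> \<noteq> 0" if "\<sigma> \<in> \<Gamma>" for \<sigma>
    using b[OF that] P(1) that by (simp add: c_def hom)
  have c_right: "c (\<sigma> \<circ> \<tau>) = c \<sigma>" if "\<sigma> \<in> \<Gamma>" "\<tau> \<in> H" for \<sigma> \<tau>
  proof -
    have "c (\<sigma> \<circ> \<tau>) = b \<sigma> * \<sigma> (a \<tau> * \<tau> P) / P"
      using right[OF that] that(1) by (simp add: c_def a_def hom)
    then show ?thesis using P(2)[OF that(2)] by (simp add: c_def)
  qed
  have c_left: "c (\<tau> \<circ> \<sigma>) = \<tau> (c \<sigma>)" if "\<sigma> \<in> \<Gamma>" "\<tau> \<in> H" for \<sigma> \<tau>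
  proof -
    have \<tau>: "\<tau> \<in> \<Gamma>" using that(2) H(1) by blast
    have "a \<tau> \<noteq> 0" using b[OF \<tau>] b[OF id] by (simp add: a_def)
    moreover have "\<tau> P \<noteq> 0" using P(1) \<tau> by (simp add: hom)
    moreover have "c (\<tau> \<circ> \<sigma>) = \<tau> (b \<sigma>) * a \<tau> * \<tau> (\<sigma> P) / (a \<tau> * \<tau> P)"
      unfolding P(2)[OF that(2)] using left[OF that] by (simp add: c_def a_def)
    ultimately show ?thesis using \<tau> by (simp add: c_def hom)
  qed
  have same: "c \<sigma> = c \<tau>" if "\<sigma> \<in> \<Gamma>" "\<tau> \<in> \<Gamma>" "res \<sigma> = res \<tau>" for \<sigma> \<tau>
  proof -
    let ?\<rho> = "inv_into UNIV \<tau> \<circ> \<sigma>"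
    have i: "inv_into UNIV \<tau> \<in> \<Gamma>" by (rule gal_inv[OF that(2)])
    then have "res ?\<rho> = id" using that inv_comp(1)[OF that(2)] by (metis res_comp res_id)
    then have "?\<rho> \<in> H" using gal_comp[OF i that(1)] unfolding H_def by blast
    then have "c (\<tau> \<circ> ?\<rho>) = c \<tau>" by (rule c_right[OF that(2)])
    moreover have "\<tau> \<circ> ?\<rho> = \<sigma>" by (simp add: o_assoc inv_comp(2)[OF that(2)])
    ultimately show ?thesis by simp
  qed
  have "c \<sigma> \<in> range j" if \<sigma>: "\<sigma> \<in> \<Gamma>" for \<sigma>
  proof (rule fixed_by_kernel)
    fix \<tau> assume \<tau>: "\<tau> \<in> \<Gamma>" "res \<tau> = id"
    have "\<tau> (c \<sigma>) = c (\<tau> \<circ> \<sigma>)" using c_left[OF \<sigma>] \<tau> unfolding H_def by simp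
    also have "\<dots> = c \<sigma>"
      by (rule same) (use \<sigma> \<tau> gal_comp res_comp in auto)
    finally show "\<tau> (c \<sigma>) = c \<sigma>" .
  qed
  then have c_j: "j (inv_into UNIV j (c \<sigma>)) = c \<sigma>" if "\<sigma> \<in> \<Gamma>" for \<sigma>
    using that by (simp add: f_inv_into_f)
  have "\<forall>g\<in>G. \<exists>\<sigma>\<in>\<Gamma>. res \<sigma> = g" using res_surj by (metis imageE)
  then obtain lft where lft: "\<And>g. g \<in> G \<Longrightarrow> lft g \<in> \<Gamma>" "\<And>g. g \<in> G \<Longrightarrow> res (lft g) = g"
    by metis
  define b0 where "b0 g = inv_into UNIV j (c (lft g))" for g
  have b0: "j (b0 g) = c (lft g)" if "g \<in> G" for g
    unfolding b0_def using c_j lft(1)[OF that] by blast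
  show thesis
  proof (rule that)
    show "b0 g \<noteq> 0" if "g \<in> G" for g
      using b0[OF that] c0[OF lft(1)[OF that]] by auto
    fix g h assume g: "g \<in> G" and h: "h \<in> G"
    let ?\<sigma> = "lft g" and ?\<tau> = "lft h"
    have \<sigma>\<tau>: "?\<sigma> \<circ> ?\<tau> \<in> \<Gamma>" using gal_comp lft(1) g h by blast
    have gh: "g \<circ> h \<in> G" by (rule gal_comp[OF g h])
    have c_gh: "c (lft (g \<circ> h)) = c (?\<sigma> \<circ> ?\<tau>)"
      using same[OF lft(1)[OF gh] \<sigma>\<tau>] lft res_comp g h gh by simp
    have "j (g (b0 h)) = ?\<sigma> (c ?\<tau>)"
      using j_res[OF lft(1)[OF g], of "b0 h"] lft(2)[OF g] b0[OF h] by simp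
    then have "j (g (b0 h) * inverse (b0 (g \<circ> h)) * b0 g) = ?\<sigma> (c ?\<tau>) * inverse (c (?\<sigma> \<circ> ?\<tau>)) * c ?\<sigma>"
      by (simp add: b0[OF gh] b0[OF g] c_gh)
    \<comment> \<open>The factors involving \<open>P\<close> cancel, \<open>\<sigma> P / P\<close>
      being a 1-cocycle.\<close>
    also have "\<dots> = ?\<sigma> (b ?\<tau>) * inverse (b (?\<sigma> \<circ> ?\<tau>)) * b ?\<sigma>"
    proof -
      have "?\<sigma> P \<noteq> 0" "?\<sigma> (?\<tau> P) \<noteq> 0" "P \<noteq> 0"
        using P(1) lft(1) g h by (simp_all add: hom)
      then show ?thesis
        using lft(1)[OF g] by (simp add: c_def hom field_simps)
    qed
    also have "\<dots> = j (z (g, h))"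
      using z[OF lft(1)[OF g] lft(1)[OF h]] lft(2)[OF g] lft(2)[OF h] by simp
    finally show "z (g, h) = g (b0 h) * inverse (b0 (g \<circ> h)) * b0 g"
      using injD[OF j.inj] by metis
  qed
qed

end

section \<open>Unit groups, the Krull topology and continuous cochains\<close>

lemma ring_of_type_algebra_simps [simp]:
  "carrier (ring_of_type_algebra :: 'a::ring_1 ring) = UNIV"
  "monoid.mult (ring_of_type_algebra :: 'a::ring_1 ring) = (*)"
  "one (ring_of_type_algebra :: 'a::ring_1 ring) = 1"
  "ring.zero (ring_of_type_algebra :: 'a::ring_1 ring) = 0"
  "add (ring_of_type_algebra :: 'a::ring_1 ring) = (+)"
  by (simp_all add: ring_of_type_algebra_def)

lemma units_group_simps:
  "carrier (units_group :: 'a::field monoid) = - {0}"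
  "monoid.mult (units_group :: 'a::field monoid) = (*)"
  "one (units_group :: 'a::field monoid) = 1"
  by auto

lemma group_units_group: "group (units_group :: 'a::field monoid)"
proof (rule groupI)
  fix x :: 'a assume "x \<in> carrier units_group"
  then show "\<exists>y\<in>carrier units_group. y \<otimes>\<^bsub>units_group\<^esub> x = \<one>\<^bsub>units_group\<^esub>"
    by (intro bexI[of _ "inverse x"]) auto
qed (auto simp: mult.assoc)

lemma inv_units_group [simp]:
  "x \<noteq> 0 \<Longrightarrow> inv\<^bsub>units_group\<^esub> x = inverse (x::'a::field)"
  by (rule group.inv_equality[OF group_units_group]) auto

lemma continuous_map_discrete_iff:
  "continuous_map T (discrete_topology D) b \<longleftrightarrow>
    b \<in> topspace T \<rightarrow> D \<and> (\<forall>x\<in>topspace T. \<exists>U. openin T U \<and> x \<in> U \<and> (\<forall>y\<in>U. b y = b x))"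
proof safe
  assume b: "continuous_map T (discrete_topology D) b"
  show "b x \<in> D" if "x \<in> topspace T" for x
    using b that by (auto simp: continuous_map_def)
  show "\<exists>U. openin T U \<and> x \<in> U \<and> (\<forall>y\<in>U. b y = b x)" if "x \<in> topspace T" for x
  proof (intro exI conjI)
    have "b x \<in> D" using b that by (auto simp: continuous_map_def)
    then show "openin T {y \<in> topspace T. b y \<in> {b x}}"
      by (intro openin_continuous_map_preimage[OF b]) auto
  qed (use that in auto)
next
  assume b: "b \<in> topspace T \<rightarrow> D" "\<forall>x\<in>topspace T. \<exists>U. openin T U \<and> x \<in> U \<and> (\<forall>y\<in>U. b y = b x)"
  have "openin T {x \<in> topspace T. b x \<in> V}" for V
  proof (subst openin_subopen, safe)
    fix x assume x: "x \<in> topspace T" "b x \<in> V"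
    then obtain U where U: "openin T U" "x \<in> U" "\<forall>y\<in>U. b y = b x" using b(2) by blast
    then have "U \<subseteq> {x \<in> topspace T. b x \<in> V}" using x openin_subset by fastforce
    then show "\<exists>T'. openin T T' \<and> x \<in> T' \<and> T' \<subseteq> {x \<in> topspace T. b x \<in> V}" using U by blast
  qed
  then show "continuous_map T (discrete_topology D) b"
    using b(1) by (simp add: continuous_map_def)
qed

lemma topspace_krull [simp]: "topspace (krull_topology \<kappa>) = carrier (gal \<kappa>)"
  by (simp add: krull_topology_def)

text \<open>A basic open set of the product constrains only the finitely many coordinates
  \<open>i\<close> with \<open>W i \<noteq> UNIV\<close>, so local constancy near
  \<open>\<sigma>\<close> means dependence on finitely many values. These finite sets are what
  \<open>hilbert_90\<close> works with.\<close>

lemma continuous_map_krull_iff: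
  "continuous_map (krull_topology \<kappa>) (discrete_topology D) b \<longleftrightarrow>
    b \<in> carrier (gal \<kappa>) \<rightarrow> D \<and>
    (\<forall>\<sigma>\<in>carrier (gal \<kappa>). \<exists>F. finite F \<and> (\<forall>\<tau>\<in>carrier (gal \<kappa>). (\<forall>x\<in>F. \<tau> x = \<sigma> x) \<longrightarrow> b \<tau> = b \<sigma>))"
proof -
  let ?G = "carrier (gal \<kappa>)" and ?P = "product_topology (\<lambda>_. discrete_topology UNIV) UNIV"
  have "(\<exists>U. openin (krull_topology \<kappa>) U \<and> \<sigma> \<in> U \<and> (\<forall>\<tau>\<in>U. b \<tau> = b \<sigma>)) \<longleftrightarrow>
      (\<exists>F. finite F \<and> (\<forall>\<tau>\<in>?G. (\<forall>x\<in>F. \<tau> x = \<sigma> x) \<longrightarrow> b \<tau> = b \<sigma>))" (is "?L \<longleftrightarrow> ?R")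
    if \<sigma>: "\<sigma> \<in> ?G" for \<sigma>
  proof
    assume ?L
    then obtain U where U: "openin (krull_topology \<kappa>) U" "\<sigma> \<in> U" "\<forall>\<tau>\<in>U. b \<tau> = b \<sigma>"
      by blast
    from U(1) obtain V where "openin ?P V" "U = V \<inter> ?G"
      unfolding krull_topology_def openin_subtopology by blast
    with U have V: "openin ?P V" "\<sigma> \<in> V" "\<And>\<tau>. \<tau> \<in> V \<Longrightarrow> \<tau> \<in> ?G \<Longrightarrow> b \<tau> = b \<sigma>"
      by blast+
    from bspec[OF iffD1[OF openin_product_topology_alt V(1)] V(2)]
    obtain W where W: "finite {i. W i \<noteq> UNIV}" "\<sigma> \<in> Pi\<^sub>E UNIV W" "Pi\<^sub>E UNIV W \<subseteq> V"
      by (elim exE conjE) (rule that; simp)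
    show ?R
    proof (intro exI conjI ballI impI)
      fix \<tau> assume \<tau>: "\<tau> \<in> ?G" "\<forall>x\<in>{i. W i \<noteq> UNIV}. \<tau> x = \<sigma> x"
      have "\<tau> x \<in> W x" for x
        using W(2) \<tau>(2) by (cases "W x = UNIV") (auto simp: PiE_iff)
      then have "\<tau> \<in> V" using W(3) by (auto simp: PiE_iff)
      then show "b \<tau> = b \<sigma>" using V(3) \<tau>(1) by blast
    qed (rule W(1))
  next
    assume ?R
    then obtain F where F: "finite F" "\<And>\<tau>. \<tau> \<in> ?G \<Longrightarrow> (\<forall>x\<in>F. \<tau> x = \<sigma> x) \<Longrightarrow> b \<tau> = b \<sigma>"
      by blast
    let ?W = "\<lambda>x. if x \<in> F then {\<sigma> x} else UNIV"
    have "finite {x. ?W x \<noteq> UNIV}"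
      by (rule finite_subset[OF _ F(1)]) auto
    then have "openin ?P (Pi\<^sub>E UNIV ?W)"
      by (subst openin_PiE_gen) simp
    then have "openin (krull_topology \<kappa>) (?G \<inter> Pi\<^sub>E UNIV ?W)"
      unfolding krull_topology_def by (rule openin_subtopology_Int2)
    moreover have "\<sigma> \<in> ?G \<inter> Pi\<^sub>E UNIV ?W"
      using \<sigma> by (simp add: PiE_iff)
    moreover have "b \<tau> = b \<sigma>" if "\<tau> \<in> ?G \<inter> Pi\<^sub>E UNIV ?W" for \<tau>
      using that by (intro F(2)) (auto simp: PiE_iff split: if_splits)
    ultimately show ?L by (intro exI[of _ "?G \<inter> Pi\<^sub>E UNIV ?W"] conjI ballI)
  qed
  then show ?thesis
    unfolding continuous_map_discrete_iff topspace_krull by (intro arg_cong2[of _ _ _ _ "(\<and>)"] ball_cong refl)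
qed

lemma coboundary_units_group:
  assumes "\<And>\<sigma>. \<sigma> \<in> carrier (gal \<kappa>) \<Longrightarrow> b \<sigma> \<noteq> 0"
  shows "coboundary (gal \<kappa>) units_group (\<lambda>\<sigma> x. \<sigma> x) b =
    (\<lambda>(\<sigma>, \<tau>)\<in>carrier (gal \<kappa>) \<times> carrier (gal \<kappa>). \<sigma> (b \<tau>) * inverse (b (\<sigma> \<circ> \<tau>)) * b \<sigma>)"
  unfolding coboundary_def
  by (rule restrict_ext) (auto simp: assms gal_comp)

definition cochains1 :: "('k::field \<Rightarrow> 's::field) \<Rightarrow> (('s \<Rightarrow> 's) \<Rightarrow> 's) set" where
  "cochains1 \<kappa> = {b. continuous_map (krull_topology \<kappa>) (discrete_topology (- {0})) b}"

lemma cochains1_nonzero: "b \<in> cochains1 \<kappa> \<Longrightarrow> \<sigma> \<in> carrier (gal \<kappa>) \<Longrightarrow> b \<sigma> \<noteq> 0"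
  unfolding cochains1_def continuous_map_krull_iff by auto

text \<open>One statement for products and, with an \<open>f\<close> that ignores its second
  argument, for inverses.\<close>

lemma cochains1_combine:
  assumes b: "b \<in> cochains1 \<kappa>" and c: "c \<in> cochains1 \<kappa>"
    and nonzero: "\<And>x y. x \<noteq> 0 \<Longrightarrow> y \<noteq> 0 \<Longrightarrow> f x y \<noteq> 0"
  shows "(\<lambda>\<sigma>. f (b \<sigma>) (c \<sigma>)) \<in> cochains1 \<kappa>"
proof -
  have "\<exists>F. finite F \<and> (\<forall>\<tau>\<in>carrier (gal \<kappa>). (\<forall>x\<in>F. \<tau> x = \<sigma> x) \<longrightarrow> f (b \<tau>) (c \<tau>) = f (b \<sigma>) (c \<sigma>))"
    if \<sigma>: "\<sigma> \<in> carrier (gal \<kappa>)" for \<sigma>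
  proof -
    obtain F where F: "finite F" "\<forall>\<tau>\<in>carrier (gal \<kappa>). (\<forall>x\<in>F. \<tau> x = \<sigma> x) \<longrightarrow> b \<tau> = b \<sigma>"
      using b \<sigma> unfolding cochains1_def continuous_map_krull_iff by blast
    obtain F' where F': "finite F'" "\<forall>\<tau>\<in>carrier (gal \<kappa>). (\<forall>x\<in>F'. \<tau> x = \<sigma> x) \<longrightarrow> c \<tau> = c \<sigma>"
      using c \<sigma> unfolding cochains1_def continuous_map_krull_iff by blast
    show ?thesis
    proof (intro exI[of _ "F \<union> F'"] conjI ballI impI)
      fix \<tau> assume "\<tau> \<in> carrier (gal \<kappa>)" "\<forall>x\<in>F \<union> F'. \<tau> x = \<sigma> x"
      then have "b \<tau> = b \<sigma>" "c \<tau> = c \<sigma>" using F(2) F'(2) by blast+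
      then show "f (b \<tau>) (c \<tau>) = f (b \<sigma>) (c \<sigma>)" by (rule arg_cong2)
    qed (use F(1) F'(1) in blast)
  qed
  moreover have "(\<lambda>\<sigma>. f (b \<sigma>) (c \<sigma>)) \<in> carrier (gal \<kappa>) \<rightarrow> - {0}"
    using cochains1_nonzero[OF b] cochains1_nonzero[OF c] nonzero by auto
  ultimately show ?thesis
    unfolding cochains1_def continuous_map_krull_iff by blast
qed

lemma cochains1_const: "x \<noteq> 0 \<Longrightarrow> (\<lambda>_. x) \<in> cochains1 \<kappa>"
  unfolding cochains1_def by simp

lemma coboundaries2_krull:
  "coboundaries2 (gal \<kappa>) (krull_topology \<kappa>) units_group (\<lambda>\<sigma> x. \<sigma> x) =
    {(\<lambda>(\<sigma>, \<tau>)\<in>carrier (gal \<kappa>) \<times> carrier (gal \<kappa>). \<sigma> (b \<tau>) * inverse (b (\<sigma> \<circ> \<tau>)) * b \<sigma>) | b. b \<in> cochains1 \<kappa>}"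
proof -
  have "coboundary (gal \<kappa>) units_group (\<lambda>\<sigma> x. \<sigma> x) b =
    (\<lambda>(\<sigma>, \<tau>)\<in>carrier (gal \<kappa>) \<times> carrier (gal \<kappa>). \<sigma> (b \<tau>) * inverse (b (\<sigma> \<circ> \<tau>)) * b \<sigma>)"
    if "b \<in> cochains1 \<kappa>" for b
    using coboundary_units_group cochains1_nonzero that by blast
  then show ?thesis
    unfolding coboundaries2_def units_group_simps cochains1_def[symmetric] Setcompr_eq_image
    by (rule image_cong[OF refl])
qed

lemma H2_Gm_class_eq:
  "H2_Gm_class \<kappa> w = {(\<lambda>p\<in>carrier (gal \<kappa>) \<times> carrier (gal \<kappa>). y p * w p) | y.
    y \<in> coboundaries2 (gal \<kappa>) (krull_topology \<kappa>) units_group (\<lambda>\<sigma> x. \<sigma> x)}"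
  unfolding H2_Gm_class_def H2_class_def r_coset_def cocycles2_def by auto

text \<open>A class consists of pointwise products with coboundaries, and the coboundary of a
  product of cochains is the product of their coboundaries. One inclusion is proved for every
  \<open>c\<close>; the inverse cochain then gives the other.\<close>

lemma H2_Gm_class_mult_coboundary:
  fixes \<kappa> :: "'k::field \<Rightarrow> 's::field"
  assumes c: "c \<in> cochains1 \<kappa>"
    and w': "\<And>\<sigma> \<tau>. \<sigma> \<in> carrier (gal \<kappa>) \<Longrightarrow> \<tau> \<in> carrier (gal \<kappa>) \<Longrightarrow>
      w' (\<sigma>, \<tau>) = \<sigma> (c \<tau>) * inverse (c (\<sigma> \<circ> \<tau>)) * c \<sigma> * w (\<sigma>, \<tau>)"
  shows "H2_Gm_class \<kappa> w' = H2_Gm_class \<kappa> w"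
proof -
  have sub: "H2_Gm_class \<kappa> w' \<subseteq> H2_Gm_class \<kappa> w"
    if c: "c \<in> cochains1 \<kappa>"
      and w': "\<And>\<sigma> \<tau>. \<sigma> \<in> carrier (gal \<kappa>) \<Longrightarrow> \<tau> \<in> carrier (gal \<kappa>) \<Longrightarrow>
        w' (\<sigma>, \<tau>) = \<sigma> (c \<tau>) * inverse (c (\<sigma> \<circ> \<tau>)) * c \<sigma> * w (\<sigma>, \<tau>)" for c w w'
  proof
    fix v assume "v \<in> H2_Gm_class \<kappa> w'"
    then obtain b where b: "b \<in> cochains1 \<kappa>"
      and v: "v = (\<lambda>p\<in>carrier (gal \<kappa>) \<times> carrier (gal \<kappa>).
        (\<lambda>(\<sigma>, \<tau>)\<in>carrier (gal \<kappa>) \<times> carrier (gal \<kappa>). \<sigma> (b \<tau>) * inverse (b (\<sigma> \<circ> \<tau>)) * b \<sigma>) p * w' p)"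
      unfolding H2_Gm_class_eq coboundaries2_krull by auto
    define e where "e \<sigma> = b \<sigma> * c \<sigma>" for \<sigma>
    have e: "e \<in> cochains1 \<kappa>"
      unfolding e_def using cochains1_combine[OF b c, of "(*)"] by simp
    have "v = (\<lambda>p\<in>carrier (gal \<kappa>) \<times> carrier (gal \<kappa>).
        (\<lambda>(\<sigma>, \<tau>)\<in>carrier (gal \<kappa>) \<times> carrier (gal \<kappa>). \<sigma> (e \<tau>) * inverse (e (\<sigma> \<circ> \<tau>)) * e \<sigma>) p * w p)"
      unfolding v e_def
      by (rule restrict_ext)
         (auto simp: w' field_embedding.hom_mult[OF gal_embedding] mult_ac)
    then show "v \<in> H2_Gm_class \<kappa> w"
      unfolding H2_Gm_class_eq coboundaries2_krull using e by blast
  qed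
  show ?thesis
  proof
    show "H2_Gm_class \<kappa> w' \<subseteq> H2_Gm_class \<kappa> w" by (rule sub[OF c w'])
    show "H2_Gm_class \<kappa> w \<subseteq> H2_Gm_class \<kappa> w'"
    proof (rule sub)
      show "(\<lambda>\<sigma>. inverse (c \<sigma>)) \<in> cochains1 \<kappa>"
        using cochains1_combine[OF c c, of "\<lambda>x _. inverse x"] by simp
      fix \<sigma> \<tau> assume \<sigma>: "\<sigma> \<in> carrier (gal \<kappa>)" and \<tau>: "\<tau> \<in> carrier (gal \<kappa>)"
      then have c0: "c \<sigma> \<noteq> 0" "c \<tau> \<noteq> 0" "c (\<sigma> \<circ> \<tau>) \<noteq> 0"
        using cochains1_nonzero[OF c] gal_comp by blast+
      have hom: "\<sigma> (inverse (c \<tau>)) = inverse (\<sigma> (c \<tau>))" "\<sigma> (c \<tau>) = 0 \<longleftrightarrow> c \<tau> = 0"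
        using field_embedding.hom_inverse[OF gal_embedding[OF \<sigma>]]
          field_embedding.hom_eq_0_iff[OF gal_embedding[OF \<sigma>]] by blast+
      have cancel: "x = inverse s * inverse (inverse u) * inverse v * (s * inverse u * v * x)"
        if "s \<noteq> 0" "u \<noteq> 0" "v \<noteq> 0" for s u v x :: 's
        using that by (simp add: field_simps)
      show "w (\<sigma>, \<tau>) =
          \<sigma> (inverse (c \<tau>)) * inverse (inverse (c (\<sigma> \<circ> \<tau>))) * inverse (c \<sigma>) * w' (\<sigma>, \<tau>)"
        unfolding w'[OF \<sigma> \<tau>] hom(1) by (rule cancel) (use c0 hom(2) in auto)
    qed
  qed
qed

text \<open>The unit of the quotient is the set of coboundaries itself, and the constant 1 is a
  coboundary, so \<open>w\<close> belongs to its own class. The members of a class are restricted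
  functions, which is why \<open>w\<close> has to be extensional.\<close>

lemma H2_Gm_class_eq_one_iff:
  assumes w: "w \<in> extensional (carrier (gal \<kappa>) \<times> carrier (gal \<kappa>))"
  shows "H2_Gm_class \<kappa> w = \<one>\<^bsub>H2_Gm \<kappa>\<^esub> \<longleftrightarrow>
    (\<exists>b\<in>cochains1 \<kappa>. \<forall>\<sigma>\<in>carrier (gal \<kappa>). \<forall>\<tau>\<in>carrier (gal \<kappa>).
      w (\<sigma>, \<tau>) = \<sigma> (b \<tau>) * inverse (b (\<sigma> \<circ> \<tau>)) * b \<sigma>)" (is "?L \<longleftrightarrow> ?R")
proof -
  let ?G = "carrier (gal \<kappa>)"
  let ?B = "coboundaries2 (gal \<kappa>) (krull_topology \<kappa>) units_group (\<lambda>\<sigma> x. \<sigma> x)"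
  have one: "\<one>\<^bsub>H2_Gm \<kappa>\<^esub> = ?B"
    by (simp add: H2_Gm_def H2_def FactGroup_def)
  have triv: "(\<lambda>(\<sigma>, \<tau>)\<in>?G \<times> ?G. 1) \<in> ?B"
  proof -
    have eq: "(\<lambda>(\<sigma>, \<tau>)\<in>?G \<times> ?G. 1) = (\<lambda>(\<sigma>, \<tau>)\<in>?G \<times> ?G. \<sigma> 1 * inverse 1 * 1)"
      by (rule restrict_ext) (auto simp: field_embedding.hom_one[OF gal_embedding])
    show ?thesis
      unfolding coboundaries2_krull
      by (intro CollectI exI[of _ "\<lambda>_. 1"] conjI eq cochains1_const one_neq_zero)
  qed
  have class_one: "H2_Gm_class \<kappa> (\<lambda>_. 1) = ?B"
  proof -
    have "restrict y (?G \<times> ?G) = y" if "y \<in> ?B" for y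
      using that unfolding coboundaries2_krull by (auto intro: extensional_restrict)
    then show ?thesis unfolding H2_Gm_class_eq Setcompr_eq_image by simp
  qed
  show ?thesis
  proof
    assume ?L
    have "w = (\<lambda>p\<in>?G \<times> ?G. (\<lambda>(\<sigma>, \<tau>)\<in>?G \<times> ?G. 1) p * w p)"
      by (rule extensionalityI[OF w]) auto
    then have "w \<in> H2_Gm_class \<kappa> w"
      unfolding H2_Gm_class_eq using triv by blast
    then have "w \<in> ?B" using \<open>?L\<close> one by simp
    then obtain b where "b \<in> cochains1 \<kappa>"
      and wb: "w = (\<lambda>(\<sigma>, \<tau>)\<in>?G \<times> ?G. \<sigma> (b \<tau>) * inverse (b (\<sigma> \<circ> \<tau>)) * b \<sigma>)"
      unfolding coboundaries2_krull by blast
    then show ?R by (intro bexI[of _ b]) (auto simp: wb)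
  next
    assume ?R
    then obtain b where "b \<in> cochains1 \<kappa>"
      "\<And>\<sigma> \<tau>. \<sigma> \<in> ?G \<Longrightarrow> \<tau> \<in> ?G \<Longrightarrow> w (\<sigma>, \<tau>) = \<sigma> (b \<tau>) * inverse (b (\<sigma> \<circ> \<tau>)) * b \<sigma>"
      by blast
    then have "H2_Gm_class \<kappa> w = H2_Gm_class \<kappa> (\<lambda>_. 1)"
      by (intro H2_Gm_class_mult_coboundary) auto
    then show ?L using class_one one by simp
  qed
qed

section \<open>Comparison of classes over \<open>L\<close> and over \<open>S\<close>\<close>

context galois_tower
begin

text \<open>The restriction of \<open>\<sigma>\<close> to \<open>L\<close> is determined by the
  finitely many values of \<open>\<sigma>\<close> on \<open>j\<close> followed by \<open>B\<close>,
  so an inflated cochain is locally constant.\<close>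

lemma res_cochain:
  assumes "\<And>g. g \<in> G \<Longrightarrow> b g \<noteq> 0"
  shows "(\<lambda>\<sigma>. j (b (res \<sigma>))) \<in> cochains1 (j \<circ> \<iota>)"
proof -
  have "res \<tau> = res \<sigma>" if "\<sigma> \<in> \<Gamma>" "\<tau> \<in> \<Gamma>" "\<forall>x\<in>j ` B. \<tau> x = \<sigma> x" for \<sigma> \<tau>
  proof (rule gal_eq_on_basis[OF ext_\<iota> basis])
    show "res \<tau> x = res \<sigma> x" if "x \<in> B" for x
      using that \<open>\<forall>x\<in>j ` B. \<tau> x = \<sigma> x\<close> by (simp add: restrict_aut_def)
  qed (use that res_in galD in \<open>auto simp: galD(3)[OF res_in]\<close>)
  moreover have "finite (j ` B)" using basis unfolding finite_basis_def by blast
  ultimately have "\<exists>F. finite F \<and> (\<forall>\<tau>\<in>\<Gamma>. (\<forall>x\<in>F. \<tau> x = \<sigma> x) \<longrightarrow> j (b (res \<tau>)) = j (b (res \<sigma>)))"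
    if "\<sigma> \<in> \<Gamma>" for \<sigma>
    using that by (intro exI[of _ "j ` B"]) metis
  moreover have "(\<lambda>\<sigma>. j (b (res \<sigma>))) \<in> \<Gamma> \<rightarrow> - {0}"
    using assms res_in by auto
  ultimately show ?thesis
    unfolding cochains1_def continuous_map_krull_iff by blast
qed

text \<open>\<open>inflation\<close> picks the element of a set of classes; \<open>same\<close>
  shows this set to be a singleton, because coboundaries inflate to coboundaries. There remains the
  class of one inflated function: a cochain on \<open>G\<close> inflates, and a continuous cochain
  on \<open>\<Gamma>\<close> comes down by \<open>inflation_injective\<close>.\<close>

theorem inflation_eq_one_iff:
  "inflation \<iota> j (H2_finite_class \<iota> z) = \<one>\<^bsub>H2_Gm (j \<circ> \<iota>)\<^esub> \<longleftrightarrow>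
    (\<exists>b. (\<forall>g\<in>G. b g \<noteq> 0) \<and> (\<forall>g\<in>G. \<forall>h\<in>G. z (g, h) = g (b h) * inverse (b (g \<circ> h)) * b g))"
proof -
  let ?infl = "inflate \<iota> j" and ?cl = "H2_Gm_class (j \<circ> \<iota>)"
  have infl: "?infl y (\<sigma>, \<tau>) = j (y (res \<sigma>, res \<tau>))" if "\<sigma> \<in> \<Gamma>" "\<tau> \<in> \<Gamma>" for y \<sigma> \<tau>
    using that by (simp add: inflate_def)
  have infl_ext: "?infl y \<in> extensional (\<Gamma> \<times> \<Gamma>)" for y
    by (simp add: inflate_def)
  have j_cob: "j (res \<sigma> (b (res \<tau>)) * inverse (b (res \<sigma> \<circ> res \<tau>)) * b (res \<sigma>)) =
      \<sigma> (j (b (res \<tau>))) * inverse (j (b (res (\<sigma> \<circ> \<tau>)))) * j (b (res \<sigma>))"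
    if "\<sigma> \<in> \<Gamma>" "\<tau> \<in> \<Gamma>" for b \<sigma> \<tau>
    using that by (simp add: j_res res_comp)
  have Y: "H2_finite_class \<iota> z = {(\<lambda>p\<in>G \<times> G. coboundary (gal \<iota>) units_group (\<lambda>g x. g x) b p * z p) | b.
      b \<in> G \<rightarrow> - {0}}"
    unfolding H2_finite_class_def H2_class_def r_coset_def cocycles2_def coboundaries2_def
    by (auto simp: Compl_eq_Diff_UNIV)
  have same: "?cl (?infl y) = ?cl (?infl z)" if y: "y \<in> H2_finite_class \<iota> z" for y
  proof -
    from y obtain b where b: "b \<in> G \<rightarrow> - {0}"
      and yb: "y = (\<lambda>p\<in>G \<times> G. coboundary (gal \<iota>) units_group (\<lambda>g x. g x) b p * z p)"
      unfolding Y by auto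
    have b0: "\<And>g. g \<in> G \<Longrightarrow> b g \<noteq> 0" using b by auto
    show ?thesis
    proof (rule H2_Gm_class_mult_coboundary)
      show "(\<lambda>\<sigma>. j (b (res \<sigma>))) \<in> cochains1 (j \<circ> \<iota>)" by (rule res_cochain[OF b0])
      fix \<sigma> \<tau> assume *: "\<sigma> \<in> \<Gamma>" "\<tau> \<in> \<Gamma>"
      show "?infl y (\<sigma>, \<tau>) = \<sigma> (j (b (res \<tau>))) * inverse (j (b (res (\<sigma> \<circ> \<tau>)))) * j (b (res \<sigma>)) * ?infl z (\<sigma>, \<tau>)"
        unfolding infl[OF *] j_cob[OF *, symmetric]
        by (simp add: yb coboundary_units_group[OF b0] res_in *)
    qed
  qed
  have "(\<lambda>g. 1 :: 'l) \<in> G \<rightarrow> - {0}" by auto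
  then have "H2_finite_class \<iota> z \<noteq> {}" unfolding Y by blast
  then have "(\<lambda>y. ?cl (?infl y)) ` H2_finite_class \<iota> z = {?cl (?infl z)}"
    using same by auto
  then have "inflation \<iota> j (H2_finite_class \<iota> z) = ?cl (?infl z)"
    unfolding inflation_def by simp
  also have "?cl (?infl z) = \<one>\<^bsub>H2_Gm (j \<circ> \<iota>)\<^esub> \<longleftrightarrow>
      (\<exists>b. (\<forall>g\<in>G. b g \<noteq> 0) \<and> (\<forall>g\<in>G. \<forall>h\<in>G. z (g, h) = g (b h) * inverse (b (g \<circ> h)) * b g))"
    unfolding H2_Gm_class_eq_one_iff[OF infl_ext]
  proof safe
    fix b assume b: "b \<in> cochains1 (j \<circ> \<iota>)"
      and *: "\<forall>\<sigma>\<in>\<Gamma>. \<forall>\<tau>\<in>\<Gamma>. ?infl z (\<sigma>, \<tau>) = \<sigma> (b \<tau>) * inverse (b (\<sigma> \<circ> \<tau>)) * b \<sigma>"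
    \<comment> \<open>Local constancy of \<open>b\<close> near \<open>id\<close> supplies the finite
      set that \<open>inflation_injective\<close> asks for.\<close>
    obtain F where F: "finite F" "\<And>\<sigma>. \<sigma> \<in> \<Gamma> \<Longrightarrow> (\<forall>x\<in>F. \<sigma> x = id x) \<Longrightarrow> b \<sigma> = b id"
      using b gal_id unfolding cochains1_def continuous_map_krull_iff by blast
    show "\<exists>b. (\<forall>g\<in>G. b g \<noteq> 0) \<and> (\<forall>g\<in>G. \<forall>h\<in>G. z (g, h) = g (b h) * inverse (b (g \<circ> h)) * b g)"
    proof (rule inflation_injective[of b F z])
      fix \<sigma> \<tau> assume "\<sigma> \<in> \<Gamma>" "\<tau> \<in> \<Gamma>"
      then show "j (z (res \<sigma>, res \<tau>)) = \<sigma> (b \<tau>) * inverse (b (\<sigma> \<circ> \<tau>)) * b \<sigma>"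
        using * infl by metis
    next
      fix \<sigma> assume "\<sigma> \<in> \<Gamma>" "\<And>x. x \<in> F \<Longrightarrow> \<sigma> x = x"
      then show "b \<sigma> = b id" by (intro F(2)) auto
    qed (use F(1) cochains1_nonzero[OF b] in auto)
  next
    fix b assume b: "\<forall>g\<in>G. b g \<noteq> 0"
      and z: "\<forall>g\<in>G. \<forall>h\<in>G. z (g, h) = g (b h) * inverse (b (g \<circ> h)) * b g"
    show "\<exists>b\<in>cochains1 (j \<circ> \<iota>). \<forall>\<sigma>\<in>\<Gamma>. \<forall>\<tau>\<in>\<Gamma>.
        ?infl z (\<sigma>, \<tau>) = \<sigma> (b \<tau>) * inverse (b (\<sigma> \<circ> \<tau>)) * b \<sigma>"
    proof (intro bexI ballI)
      show "(\<lambda>\<sigma>. j (b (res \<sigma>))) \<in> cochains1 (j \<circ> \<iota>)" using b by (intro res_cochain) blast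
      fix \<sigma> \<tau> assume *: "\<sigma> \<in> \<Gamma>" "\<tau> \<in> \<Gamma>"
      show "?infl z (\<sigma>, \<tau>) = \<sigma> (j (b (res \<tau>))) * inverse (j (b (res (\<sigma> \<circ> \<tau>)))) * j (b (res \<sigma>))"
        unfolding infl[OF *] j_cob[OF *, symmetric] using z * res_in by metis
    qed
  qed
  finally show ?thesis .
qed

end

text \<open>Both sides are equivalent to the existence of a descent datum on \<open>M\<close>, a
  condition in which neither \<open>S\<close> nor the chosen family \<open>c\<close> occurs.\<close>

theorem corollary4p6:
  fixes \<iota> :: "'k::field \<Rightarrow> 'l::field"
    and j :: "'l \<Rightarrow> 's::field"
    and C :: "('k, 'o, 'm) lincat"
    and M :: "'o \<times> ('l \<Rightarrow> 'm)"
    and c :: "('l \<Rightarrow> 'l) \<Rightarrow> 'm"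
  assumes "abelian_linear_category C"
    and "galois_extension \<iota>" and "\<exists>B. finite_basis \<iota> B"
    and "field_extension j" and "separable_closure (j \<circ> \<iota>)"
    and "M \<in> Ob (base_change \<iota> C)"
    and "\<forall>g\<in>carrier (gal \<iota>). isomorphic (base_change \<iota> C) M (twist g M)"
    and "bij_betw (snd M) UNIV (Hom (base_change \<iota> C) M M)"
    and "\<forall>g\<in>carrier (gal \<iota>). c g \<in> isos (base_change \<iota> C) M (twist g M)"
  shows "inflation \<iota> j (xi_class \<iota> C M c) = \<one>\<^bsub>H2_Gm (j \<circ> \<iota>)\<^esub> \<longleftrightarrow> descends \<iota> C M"
proof -
  obtain B where B: "finite_basis \<iota> B" using assms(3) by blast
  obtain N0 f where M_eq: "M = (N0, f)" by (cases M)
  interpret abelian_linear_category C by (rule assms(1))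
  interpret galois_module C \<iota> B N0 f
    using assms(2,6) B M_eq by unfold_locales auto
  interpret T: galois_tower \<iota> j B
    using assms(2,4,5) B unfolding separable_closure_def by unfold_locales auto
  have "inflation \<iota> j (xi_class \<iota> C M c) = \<one>\<^bsub>H2_Gm (j \<circ> \<iota>)\<^esub> \<longleftrightarrow> (\<exists>c'. descent_datum c')"
    unfolding xi_class_def T.inflation_eq_one_iff M_eq
    by (rule xi_coboundary_iff_datum) (use assms(8,9) M_eq in auto)
  also have "\<dots> \<longleftrightarrow> descends \<iota> C M"
    unfolding M_eq using datum_imp_descends descends_imp_datum by blast
  finally show ?thesis .
qed

end
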